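(* Let $C,D\subset\mathbb{R}^d$ be polyhedral cones with $\dim C=i$, $\dim D=j$, where $i+j=d-k<d$. Let $f:[0,1]\to\mathbb{R}$ be bounded and measurable. Then $$\int_{\mathrm{SO}_d}V_{d-k}(C+\vartheta D)\,f([C,\vartheta D])\,\nu(\mathrm{d}\vartheta)=c_{ij}(f)\,V_i(C)\,V_j(D).$$
   Context: Work in $\mathbb{R}^d$, $d\ge2$. $\nu$ is the Haar probability measure on $\mathrm{SO}_d$; $\gamma_L$ is the standard Gaussian measure on a linear subspace $L$, $\gamma_d=\gamma_{\mathbb{R}^d}$. A polyhedral cone is $\mathbb{R}^d$ or a finite intersection of closed halfspaces whose boundaries contain the origin; $\mathcal{F}_k(C)$ its set of $k$-faces, $L(F)$ the linear hull of $F$, $N(C,F)=\{y:\langle y,x\rangle\le0\ \forall x\in C,\ \langle y,x\rangle=0\ \forall x\in F\}$. Conic intrinsic volumes: $V_k(C)=\sum_{F\in\mathcal{F}_k(C)}\gamma_d(F+N(C,F))$ (zero if no $k$-faces); these do not depend on the ambient space, so for an $m$-dimensional cone $V_m(C)=\gamma_{L(C)}(C)$. Generalized sine: for linear subspaces $L_1,L_2$ with $\dim L_1+\dim L_2=m\le d$, $[L_1,L_2]$ is the $m$-dimensional volume of the parallelepiped spanned by the union of orthonormal bases of $L_1$ and $L_2$ (equal to $1$ if one subspace is $\{o\}$); if $\dim L_1+\dim L_2\ge d$, $[L_1,L_2]:=[L_1^\perp,L_2^\perp]$; $[C,D]:=[L(C),L(D)]$. For cones of dimensions $i,j$, $c_{ij}(f):=\int_{\mathrm{SO}_d}f([C,\vartheta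 D])\,\nu(\mathrm{d}\vartheta)$, which depends only on $i,j,f$. *)

theory Defs
  imports "HOL-Probability.Probability" "HOL-Combinatorics.Permutations"
begin

definition polyhedral_cone :: "(real^'n) set \<Rightarrow> bool" where
  "polyhedral_cone C \<longleftrightarrow> (\<exists>S. finite S \<and> C = {x. \<forall>a\<in>S. a \<bullet> x \<le> 0})"

definition k_faces :: "nat \<Rightarrow> (real^'n) set \<Rightarrow> (real^'n) set set" where
  "k_faces k C = {F. F face_of C \<and> aff_dim F = int k}"

definition normal_cone :: "(real^'n) set \<Rightarrow> (real^'n) set \<Rightarrow> (real^'n) set" where
  "normal_cone C F = {y. (\<forall>x\<in>C. y \<bullet> x \<le> 0) \<and> (\<forall>x\<in>F. y \<bullet> x = 0)}"

definition minkowski_sum :: "(real^'n) set \<Rightarrow> (real^'n) set \<Rightarrow> (real^'n) set" where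
  "minkowski_sum A B = {x + y | x y. x \<in> A \<and> y \<in> B}"

definition std_gaussian :: "(real^'n) measure" where
  "std_gaussian = density lborel
     (\<lambda>x. ennreal (exp (- (norm x)\<^sup>2 / 2) / (2 * pi) powr (real CARD('n) / 2)))"

definition conic_intrinsic_volume :: "nat \<Rightarrow> (real^'n) set \<Rightarrow> real" where
  "conic_intrinsic_volume k C =
     (\<Sum>F\<in>k_faces k C. measure std_gaussian (minkowski_sum F (normal_cone C F)))"

definition gram_det :: "(real^'n) list \<Rightarrow> real" where
  "gram_det vs = (\<Sum>p | p permutes {..<length vs}.
      of_int (sign p) * (\<Prod>i<length vs. (vs ! i) \<bullet> (vs ! (p i))))"

definition parallelepiped_volume :: "(real^'n) list \<Rightarrow> real" where
  "parallelepiped_volume vs = sqrt \<bar>gram_det vs\<bar>"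

definition is_onb :: "(real^'n) set \<Rightarrow> (real^'n) list \<Rightarrow> bool" where
  "is_onb L bs \<longleftrightarrow> distinct bs \<and> set bs \<subseteq> L \<and> span (set bs) = L \<and>
     (\<forall>u\<in>set bs. norm u = 1) \<and> pairwise orthogonal (set bs)"

definition onb :: "(real^'n) set \<Rightarrow> (real^'n) list" where
  "onb L = (SOME bs. is_onb L bs)"

definition gen_sine0 :: "(real^'n) set \<Rightarrow> (real^'n) set \<Rightarrow> real" where
  "gen_sine0 L1 L2 = parallelepiped_volume (onb L1 @ onb L2)"

text \<open>[L1,L2] for linear subspaces; [L1,L2] := [L1^perp, L2^perp] when dim L1 + dim L2 \<ge> d
  (for dim sum = d both readings coincide; we use the direct one then).\<close>
definition gen_sine :: "(real^'n) set \<Rightarrow> (real^'n) set \<Rightarrow> real" where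
  "gen_sine L1 L2 = (if dim L1 + dim L2 \<le> CARD('n) then gen_sine0 L1 L2
                      else gen_sine0 (orthogonal_comp L1) (orthogonal_comp L2))"

definition cone_sine :: "(real^'n) set \<Rightarrow> (real^'n) set \<Rightarrow> real" where
  "cone_sine C D = gen_sine (span C) (span D)"

definition SO :: "(real^'n^'n) set" where
  "SO = {Q. orthogonal_matrix Q \<and> det Q = 1}"

definition rot :: "real^'n^'n \<Rightarrow> (real^'n) set \<Rightarrow> (real^'n) set" where
  "rot Q D = (\<lambda>x. Q *v x) ` D"

text \<open>nu is the Haar probability measure on SO_d: a probability measure on the Borel sets of
  SO_d that is invariant under left translations (unique by uniqueness of Haar measure).\<close>
definition haar_SO :: "(real^'n^'n) measure \<Rightarrow> bool" where
  "haar_SO nu \<longleftrightarrow> prob_space nu \<and> space nu = SO \<and>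
     sets nu = sets (restrict_space borel SO) \<and>
     (\<forall>Q\<in>SO. \<forall>A\<in>sets nu. emeasure nu ((\<lambda>R. Q ** R) ` A) = emeasure nu A)"

end

theory Submission
  imports Defs "Jordan_Normal_Form.Determinant"
begin

text \<open>Put \<open>L = span C\<close>, \<open>M = span D\<close> and let \<open>\<gamma>\<close> be the standard Gaussian measure, so that the
  top conic intrinsic volumes are \<open>V(C) = \<gamma>{P\<^sub>L x \<in> C}\<close> and \<open>V(D) = \<gamma>{P\<^sub>M y \<in> D}\<close>. If \<open>\<theta>\<close> is such that
  \<open>L \<inter> \<theta> M = {0}\<close>, which holds almost surely, then the linear change of variables
  \<open>(x, y) \<mapsto> x + \<theta> y\<close> gives \<open>V(C + \<theta> D) = W\<^sub>\<theta>(C, D) / W\<^sub>\<theta>(L, M)\<close>, where \<open>W\<^sub>\<theta>(C, D)\<close> is the integral of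
  \<open>exp (- P\<^sub>L x \<bullet> \<theta> P\<^sub>M y)\<close> over \<open>{P\<^sub>L x \<in> C, P\<^sub>M y \<in> D}\<close> with respect to \<open>\<gamma> \<otimes> \<gamma>\<close>; the Jacobian is eliminated by
  the case \<open>C = L\<close>, \<open>D = M\<close>. Both \<open>W\<^sub>\<theta>(L, M)\<close> and the generalized sine are unchanged when \<open>\<theta>\<close> is
  multiplied on the left by a rotation preserving \<open>L\<close> or on the right by one preserving \<open>M\<close>. Since
  the Haar measure is two-sided invariant and \<open>dim L, dim M < d\<close>, the integral over \<open>\<theta>\<close> of
  \<open>f([L, \<theta> M]) exp (- x \<bullet> \<theta> y) / W\<^sub>\<theta>(L, M)\<close> depends on \<open>x \<in> L\<close> and \<open>y \<in> M\<close> only through their norms.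
  Under \<open>\<gamma>\<close> the norm and the direction of a projection are independent, so the cones split off as the
  factors \<open>V(C)\<close> and \<open>V(D)\<close>.\<close>

text \<open>The hypothesis i + j < d enters twice. It makes \<open>L\<close> and
  \<open>\<theta> M\<close> meet trivially almost surely, and it leaves for each of \<open>L\<close>
  and \<open>M\<close> a nonzero orthogonal vector. A reflection in such a vector corrects the sign
  of a determinant, so that rotations of determinant 1 preserving the subspace already act
  transitively on its spheres. The generalized sine is defined through arbitrarily chosen
  orthonormal bases, chosen anew for every \<open>\<theta>\<close>. Its invariance and its
  measurability in \<open>\<theta>\<close> both rest on the fact that a Gram determinant does not
  see the choice, whence the initial study of Gram determinants. All integrals run over the whole
  space with projections inserted, so subspaces never carry measures of their own. They are extended
  integrals of nonnegative functions, for which Fubini asks only for measurability; a bounded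
  \<open>f\<close> of either sign is reached at the end by adding a constant.\<close>

no_notation Matrix.scalar_prod (infix "\<bullet>" 70)
no_notation Matrix.vec_index (infixl "$" 100)

subsection \<open>Gram determinants\<close>

lemma gram_det_eq_det:
  "gram_det vs = Determinant.det (Matrix.mat (length vs) (length vs) (\<lambda>(i, j). vs ! i \<bullet> vs ! j))"
proof -
  have "Determinant.det (Matrix.mat (length vs) (length vs) (\<lambda>(i, j). vs ! i \<bullet> vs ! j)) =
    (\<Sum>p | p permutes {0..<length vs}. of_int (sign p) * (\<Prod>i = 0..<length vs. vs ! i \<bullet> vs ! p i))"
    unfolding Determinant.det_def' [OF mat_carrier]
    by (intro sum.cong refl arg_cong2[where f = "(*)"] prod.cong)
       (auto simp: permutes_in_image dest: permutes_in_image)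
  then show ?thesis by (simp add: gram_det_def lessThan_atLeast0)
qed

text \<open>The Gram matrix \<open>G\<close> of \<open>vs\<close> turns into the congruent matrix
  S^T G S, and determinants are multiplicative.\<close>

lemma gram_det_change:
  fixes vs vs' :: "(real^'n) list"
  assumes S: "S \<in> carrier_mat m m" and len: "length vs = m" "length vs' = m"
    and ch: "\<And>j. j < m \<Longrightarrow> vs' ! j = (\<Sum>i<m. S $$ (i, j) *\<^sub>R vs ! i)"
  shows "gram_det vs' = (Determinant.det S)\<^sup>2 * gram_det vs"
proof -
  let ?G = "Matrix.mat m m (\<lambda>(i, j). vs ! i \<bullet> vs ! j)"
  let ?G' = "Matrix.mat m m (\<lambda>(i, j). vs' ! i \<bullet> vs' ! j)"
  have "?G' = transpose_mat S * (?G * S)"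
  proof (rule eq_matI)
    fix j k assume "j < dim_row (transpose_mat S * (?G * S))" "k < dim_col (transpose_mat S * (?G * S))"
    then have jk: "j < m" "k < m" using S by auto
    have "vs' ! j \<bullet> vs' ! k = (\<Sum>i<m. S $$ (i, j) * (vs ! i \<bullet> (\<Sum>l<m. S $$ (l, k) *\<^sub>R vs ! l)))"
      unfolding ch[OF jk(1)] ch[OF jk(2)] by (simp only: inner_sum_left inner_scaleR_left)
    also have "\<dots> = (\<Sum>i<m. S $$ (i, j) * (\<Sum>l<m. (vs ! i \<bullet> vs ! l) * S $$ (l, k)))"
      by (simp only: inner_sum_right inner_scaleR_right mult.commute)
    also have "\<dots> = (transpose_mat S * (?G * S)) $$ (j, k)"
      using S jk by (auto simp: scalar_prod_def lessThan_atLeast0 intro!: sum.cong)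
    finally show "?G' $$ (j, k) = (transpose_mat S * (?G * S)) $$ (j, k)" using jk by simp
  qed (use S in auto)
  then have "Determinant.det ?G' = Determinant.det (transpose_mat S * (?G * S))" by simp
  also have "\<dots> = Determinant.det S * (Determinant.det ?G * Determinant.det S)"
    using Determinant.det_mult[of "transpose_mat S" m "?G * S"] Determinant.det_mult[of ?G m S]
      Determinant.det_transpose[OF S] S mult_carrier_mat[OF mat_carrier S] by simp
  finally show ?thesis using len by (simp add: gram_det_eq_det power2_eq_square)
qed

lemma gram_det_Cons_orthogonal:
  assumes "\<And>u. u \<in> set us \<Longrightarrow> q \<bullet> u = 0"
  shows "gram_det (q # us) = (q \<bullet> q) * gram_det us"
proof -
  let ?m = "length us"
  let ?G = "Matrix.mat ?m ?m (\<lambda>(i, j). us ! i \<bullet> us ! j)"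
  have "Matrix.mat (Suc ?m) (Suc ?m) (\<lambda>(i, j). (q # us) ! i \<bullet> (q # us) ! j)
    = four_block_mat (Matrix.mat 1 1 (\<lambda>_. q \<bullet> q)) (0\<^sub>m 1 ?m) (0\<^sub>m ?m 1) ?G"
  proof (rule eq_matI, goal_cases)
    case (1 i j)
    have "us ! k \<bullet> q = 0" "q \<bullet> us ! k = 0" if "k < ?m" for k
      using assms[of "us ! k"] that by (simp_all add: inner_commute)
    then show ?case using 1 by (cases i; cases j) auto
  qed auto
  then show ?thesis
    by (simp add: gram_det_eq_det Determinant.det_four_block_mat_upper_right_zero[of _ 1 _ ?m] det_single)
qed

lemma gram_det_snoc_orthogonal:
  assumes "\<And>u. u \<in> set us \<Longrightarrow> q \<bullet> u = 0"
  shows "gram_det (us @ [q]) = (q \<bullet> q) * gram_det us"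
proof -
  let ?m = "length us"
  let ?G = "Matrix.mat ?m ?m (\<lambda>(i, j). us ! i \<bullet> us ! j)"
  have "Matrix.mat (Suc ?m) (Suc ?m) (\<lambda>(i, j). (us @ [q]) ! i \<bullet> (us @ [q]) ! j)
    = four_block_mat ?G (0\<^sub>m ?m 1) (0\<^sub>m 1 ?m) (Matrix.mat 1 1 (\<lambda>_. q \<bullet> q))"
  proof (rule eq_matI, goal_cases)
    case (1 i j)
    have "us ! k \<bullet> q = 0" "q \<bullet> us ! k = 0" if "k < ?m" for k
      using assms[of "us ! k"] that by (simp_all add: inner_commute)
    then show ?case using 1 by (auto simp: nth_append less_Suc_eq)
  qed auto
  then show ?thesis
    by (simp add: gram_det_eq_det Determinant.det_four_block_mat_upper_right_zero[of _ ?m _ 1] det_single)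
qed

text \<open>Coefficients are attached to positions rather than to vectors, so repeated entries cause
  no trouble and the coefficients can become matrix entries.\<close>

lemma span_set_list:
  fixes us :: "'a::real_vector list"
  assumes "p \<in> span (set us)"
  shows "\<exists>c. p = (\<Sum>i<length us. c i *\<^sub>R us ! i)"
  using assms
proof (induction us arbitrary: p)
  case Nil
  then show ?case by simp
next
  case (Cons u us)
  then obtain k where "p - k *\<^sub>R u \<in> span (set us)" by (auto simp: span_insert)
  then obtain c where c: "p - k *\<^sub>R u = (\<Sum>i<length us. c i *\<^sub>R us ! i)" using Cons.IH by blast
  have "p = k *\<^sub>R u + (\<Sum>i<length us. c i *\<^sub>R us ! i)" using c by (simp add: algebra_simps)
  also have "\<dots> = (\<Sum>i<length (u # us). (case i of 0 \<Rightarrow> k | Suc i \<Rightarrow> c i) *\<^sub>R (u # us) ! i)"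
    by (simp add: sum.lessThan_Suc_shift del: sum.lessThan_Suc)
  finally show ?case by blast
qed

lemma gram_det_Cons:
  fixes us :: "(real^'n) list"
  assumes p: "p \<in> span (set us)" and q: "\<And>u. u \<in> set us \<Longrightarrow> q \<bullet> u = 0"
  shows "gram_det ((p + q) # us) = (q \<bullet> q) * gram_det us"
proof -
  let ?m = "Suc (length us)"
  obtain c where c: "p = (\<Sum>i<length us. c i *\<^sub>R us ! i)" using span_set_list[OF p] by blast
  define S where "S = Matrix.mat ?m ?m (\<lambda>(i, j). if j = 0 then (case i of 0 \<Rightarrow> 1 | Suc i \<Rightarrow> c i) else of_bool (i = j))"
  have S: "S \<in> carrier_mat ?m ?m" by (simp add: S_def)
  have "((p + q) # us) ! j = (\<Sum>i<?m. S $$ (i, j) *\<^sub>R (q # us) ! i)" if "j < ?m" for j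
  proof (cases j)
    case 0
    then show ?thesis
      by (simp add: S_def c sum.lessThan_Suc_shift add.commute del: sum.lessThan_Suc)
  next
    case (Suc k)
    then have "(\<Sum>i<?m. S $$ (i, j) *\<^sub>R (q # us) ! i) = (\<Sum>i<?m. if i = j then (q # us) ! i else 0)"
      using that by (intro sum.cong) (auto simp: S_def)
    then show ?thesis using that Suc by (simp add: sum.delta)
  qed
  then have "gram_det ((p + q) # us) = (Determinant.det S)\<^sup>2 * gram_det (q # us)"
    by (intro gram_det_change[OF S]) auto
  moreover have "Determinant.det S = 1"
  proof -
    have "diag_mat S = replicate ?m 1"
      by (intro replicate_eqI) (auto simp: S_def diag_mat_def split: nat.split)
    then show ?thesis
      by (subst Determinant.det_lower_triangular[OF _ S]) (auto simp: S_def)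
  qed
  ultimately show ?thesis by (simp add: gram_det_Cons_orthogonal q)
qed

text \<open>The version at the other end of the list is required because the basis of the left
  subspace is exchanged while the vectors to its right are removed one at a time.\<close>

lemma gram_det_snoc:
  fixes us :: "(real^'n) list"
  assumes p: "p \<in> span (set us)" and q: "\<And>u. u \<in> set us \<Longrightarrow> q \<bullet> u = 0"
  shows "gram_det (us @ [p + q]) = (q \<bullet> q) * gram_det us"
proof -
  let ?n = "length us"
  let ?m = "Suc ?n"
  obtain c where c: "p = (\<Sum>i<length us. c i *\<^sub>R us ! i)" using span_set_list[OF p] by blast
  define S where "S = Matrix.mat ?m ?m (\<lambda>(i, j). if j = ?n \<and> i < ?n then c i else of_bool (i = j))"
  have S: "S \<in> carrier_mat ?m ?m" by (simp add: S_def)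
  have "(us @ [p + q]) ! j = (\<Sum>i<?m. S $$ (i, j) *\<^sub>R (us @ [q]) ! i)" if "j < ?m" for j
  proof (cases "j = ?n")
    case True
    then show ?thesis by (simp add: S_def c nth_append)
  next
    case False
    then have "(\<Sum>i<?m. S $$ (i, j) *\<^sub>R (us @ [q]) ! i) = (\<Sum>i<?m. if i = j then (us @ [q]) ! i else 0)"
      using that by (intro sum.cong) (auto simp: S_def)
    then show ?thesis using that False by (simp add: sum.delta nth_append)
  qed
  then have "gram_det (us @ [p + q]) = (Determinant.det S)\<^sup>2 * gram_det (us @ [q])"
    by (intro gram_det_change[OF S]) auto
  moreover have "Determinant.det S = 1"
  proof -
    have "diag_mat S = replicate ?m 1"
      by (intro replicate_eqI) (auto simp: S_def diag_mat_def)
    then show ?thesis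
      by (subst Determinant.det_upper_triangular[OF _ S]) (auto simp: S_def upper_triangular_def)
  qed
  ultimately show ?thesis by (simp add: gram_det_snoc_orthogonal q)
qed

lemma gram_det_Nil [simp]: "gram_det [] = 1"
  by (simp add: gram_det_def)

hide_const (open) Matrix.mat Determinant.det Matrix.row Matrix.col Matrix.transpose_mat Matrix.vec
  Matrix.orthogonal
hide_type (open) Matrix.vec
hide_fact (open) Matrix.orthogonal_def Determinant.det_def

subsection \<open>Linear maps and the Gaussian measure\<close>

lemma nn_integral_lborel_translate:
  fixes F :: "'a::euclidean_space \<Rightarrow> ennreal"
  assumes [measurable]: "F \<in> borel_measurable borel"
  shows "(\<integral>\<^sup>+x. F (a + x) \<partial>lborel) = (\<integral>\<^sup>+x. F x \<partial>lborel)"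
  by (subst (2) lborel_distr_plus[of a, symmetric]) (simp add: nn_integral_distr)

lemma nn_integral_lborel_uminus:
  fixes F :: "'a::euclidean_space \<Rightarrow> ennreal"
  assumes [measurable]: "F \<in> borel_measurable borel"
  shows "(\<integral>\<^sup>+x. F (- x) \<partial>lborel) = (\<integral>\<^sup>+x. F x \<partial>lborel)"
proof -
  have "distr lborel borel (uminus :: 'a \<Rightarrow> 'a) = lborel"
    using lborel_affine[of "-1::real" "0::'a"] by (simp add: density_1)
  then have "(\<integral>\<^sup>+x. F x \<partial>lborel) = (\<integral>\<^sup>+x. F x \<partial>distr lborel borel uminus)"
    by simp
  then show ?thesis by (simp add: nn_integral_distr)
qed

text \<open>The image of Lebesgue measure under a linear bijection is translation invariant, so the
  usual Fubini argument for uniqueness of invariant measures applies.\<close>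

lemma nn_integral_lborel_linear_prod:
  fixes A :: "'a::euclidean_space \<Rightarrow> 'a"
  assumes lin: "linear A" and bij: "bij A"
    and [measurable]: "F \<in> borel_measurable borel" "G \<in> borel_measurable borel"
  shows "(\<integral>\<^sup>+x. F (A x) \<partial>lborel) * (\<integral>\<^sup>+x. G x \<partial>lborel) =
    (\<integral>\<^sup>+x. G (A x) \<partial>lborel) * (\<integral>\<^sup>+x. F x \<partial>lborel)"
proof -
  have [measurable]: "A \<in> borel_measurable borel"
    using lin by (simp add: borel_measurable_continuous_onI linear_continuous_on linear_linear)
  have "(\<integral>\<^sup>+x. F (A x) \<partial>lborel) * (\<integral>\<^sup>+x. G x \<partial>lborel)
      = (\<integral>\<^sup>+x. F (A x) * (\<integral>\<^sup>+y. G y \<partial>lborel) \<partial>lborel)"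
    by (simp add: nn_integral_multc)
  also have "\<dots> = (\<integral>\<^sup>+x. F (A x) * (\<integral>\<^sup>+y. G (A x + y) \<partial>lborel) \<partial>lborel)"
    by (simp add: nn_integral_lborel_translate)
  also have "\<dots> = (\<integral>\<^sup>+x. (\<integral>\<^sup>+y. F (A x) * G (A x + y) \<partial>lborel) \<partial>lborel)"
    by (simp add: nn_integral_cmult)
  also have "\<dots> = (\<integral>\<^sup>+y. (\<integral>\<^sup>+x. F (A x) * G (A x + y) \<partial>lborel) \<partial>lborel)"
    by (rule lborel_pair.Fubini') measurable
  \<comment> \<open>For fixed \<open>y\<close>, translating \<open>x\<close> by a preimage of
    \<open>y\<close> under \<open>A\<close> shifts \<open>A x\<close> by \<open>y\<close>; this
    moves the shift from \<open>G\<close> to \<open>F\<close>.\<close>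
  also have "\<dots> = (\<integral>\<^sup>+y. (\<integral>\<^sup>+x. F (A x - y) * G (A x) \<partial>lborel) \<partial>lborel)"
  proof (rule nn_integral_cong)
    fix y
    obtain z where z: "A z = y" using bij by (metis bij_pointE)
    have "(\<integral>\<^sup>+x. F (A x) * G (A x + y) \<partial>lborel) = (\<integral>\<^sup>+x. F (A (- z + x)) * G (A (- z + x) + y) \<partial>lborel)"
      by (subst nn_integral_lborel_translate) auto
    also have "\<dots> = (\<integral>\<^sup>+x. F (A x - y) * G (A x) \<partial>lborel)"
      by (simp add: linear_add[OF lin] linear_diff[OF lin] linear_neg[OF lin] z)
    finally show "(\<integral>\<^sup>+x. F (A x) * G (A x + y) \<partial>lborel) = (\<integral>\<^sup>+x. F (A x - y) * G (A x) \<partial>lborel)" .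
  qed
  also have "\<dots> = (\<integral>\<^sup>+x. (\<integral>\<^sup>+y. F (A x - y) * G (A x) \<partial>lborel) \<partial>lborel)"
    by (rule lborel_pair.Fubini') measurable
  also have "\<dots> = (\<integral>\<^sup>+x. (\<integral>\<^sup>+y. F (A x - y) \<partial>lborel) * G (A x) \<partial>lborel)"
    by (simp add: nn_integral_multc)
  also have "\<dots> = (\<integral>\<^sup>+x. (\<integral>\<^sup>+y. F y \<partial>lborel) * G (A x) \<partial>lborel)"
  proof -
    have "(\<integral>\<^sup>+y. F (a - y) \<partial>lborel) = (\<integral>\<^sup>+y. F y \<partial>lborel)" for a
      using nn_integral_lborel_uminus[of "\<lambda>y. F (a + y)"] by (simp add: nn_integral_lborel_translate)
    then show ?thesis by simp
  qed
  also have "\<dots> = (\<integral>\<^sup>+x. G (A x) \<partial>lborel) * (\<integral>\<^sup>+x. F x \<partial>lborel)"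
    by (simp add: nn_integral_cmult mult.commute[of _ "integral\<^sup>N lborel F"])
  finally show ?thesis .
qed

lemma emeasure_lborel_open_pos:
  fixes U :: "'a::euclidean_space set"
  assumes "open U" "U \<noteq> {}"
  shows "emeasure lborel U \<noteq> 0"
proof
  assume "emeasure lborel U = 0"
  then have "U \<in> null_sets lborel"
    using assms(1) by (simp add: null_sets_def)
  then have "negligible U"
    by (simp add: negligible_iff_null_sets null_sets_completionI)
  then show False using open_not_negligible assms by blast
qed

lemma ennreal_pos_finite:
  assumes "x \<noteq> 0" "x < \<infinity>"
  obtains u :: real where "x = ennreal u" "u > 0"
  using assms by (cases x) (auto simp: less_le)

text \<open>Testing the product identity against the indicator of the unit ball isolates the
  constant: it is the volume of the ball divided by that of its preimage. Both are positive and
  finite, the preimage being open, bounded and containing 0.\<close>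

lemma nn_integral_lborel_linear:
  fixes A :: "'a::euclidean_space \<Rightarrow> 'a"
  assumes lin: "linear A" and bij: "bij A"
  obtains c :: real where "c > 0"
    "\<And>F. F \<in> borel_measurable borel \<Longrightarrow>
       (\<integral>\<^sup>+x. F x \<partial>lborel) = ennreal c * (\<integral>\<^sup>+x. F (A x) \<partial>lborel)"
proof -
  have [measurable]: "A \<in> borel_measurable borel"
    using lin by (simp add: borel_measurable_continuous_onI linear_continuous_on linear_linear)
  obtain B where B: "linear B" "\<And>x. B (A x) = x" "\<And>x. A (B x) = x"
    using lin bij by (metis bij_is_inj bij_is_surj linear_injective_isomorphism)
  let ?U = "A -` ball 0 1"
  have U: "?U = B ` ball 0 1"
  proof safe
    fix x assume "A x \<in> ball 0 1"
    then show "x \<in> B ` ball 0 1" using B(2)[of x] by (metis image_eqI)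
  qed (simp add: B)
  have oU: "open ?U"
    by (rule open_vimage) (use lin in \<open>auto simp: linear_continuous_on linear_linear\<close>)
  have "0 \<in> ?U" by (simp add: linear_0[OF lin])
  then have "emeasure lborel ?U \<noteq> 0"
    using emeasure_lborel_open_pos[OF oU] by blast
  moreover have "bounded ?U"
    unfolding U using B(1) by (simp add: bounded_linear_image linear_linear)
  then have "emeasure lborel ?U < \<infinity>" by (rule emeasure_bounded_finite)
  ultimately obtain u :: real where u: "emeasure lborel ?U = ennreal u" "u > 0"
    by (rule ennreal_pos_finite) (rule that)
  have "emeasure lborel (ball (0::'a) 1) \<noteq> 0" by (rule emeasure_lborel_open_pos) simp_all
  then obtain v :: real where v: "emeasure lborel (ball (0::'a) 1) = ennreal v" "v > 0"
    by (rule ennreal_pos_finite[OF _ emeasure_lborel_ball_finite]) (rule that)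
  show thesis
  proof
    show "v / u > 0" using u v by simp
    fix F :: "'a \<Rightarrow> ennreal" assume [measurable]: "F \<in> borel_measurable borel"
    have "(\<integral>\<^sup>+x. F (A x) \<partial>lborel) * (\<integral>\<^sup>+x. indicator (ball (0::'a) 1) x \<partial>lborel) =
    (\<integral>\<^sup>+x. indicator (ball 0 1) (A x) \<partial>lborel) * (\<integral>\<^sup>+x. F x \<partial>lborel)"
      by (rule nn_integral_lborel_linear_prod[OF lin bij, where G = "indicator (ball 0 1)"])
        (fact, rule borel_measurable_indicator, rule borel_open, rule open_ball)
    also have "(\<integral>\<^sup>+x. indicator (ball 0 1) (A x) \<partial>lborel) = (\<integral>\<^sup>+x. indicator ?U x \<partial>lborel)"
      by (rule nn_integral_cong) (simp add: indicator_def)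
    also have "\<dots> = ennreal u" using oU u by simp
    finally have "(\<integral>\<^sup>+x. F (A x) \<partial>lborel) * ennreal v = ennreal u * (\<integral>\<^sup>+x. F x \<partial>lborel)"
      using v by simp
    then have "ennreal (1/u) * ((\<integral>\<^sup>+x. F (A x) \<partial>lborel) * ennreal v) = ennreal (1/u) * ennreal u * (\<integral>\<^sup>+x. F x \<partial>lborel)"
      by (simp add: mult.assoc)
    moreover have "ennreal (1/u) * ennreal u = 1" "ennreal (1/u) * ennreal v = ennreal (v/u)"
      using u v by (simp_all flip: ennreal_mult)
    ultimately show "(\<integral>\<^sup>+x. F x \<partial>lborel) = ennreal (v/u) * (\<integral>\<^sup>+x. F (A x) \<partial>lborel)"
      by (metis mult.left_commute mult.commute mult_1)
  qed
qed

section \<open>Density and rotation invariance of the standard Gaussian measure\<close>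

definition gauss_dens :: "real^'n \<Rightarrow> real" where
  "gauss_dens x = exp (- (norm x)\<^sup>2 / 2) / (2 * pi) powr (real CARD('n) / 2)"

lemma gauss_dens_pos: "gauss_dens x > 0"
  by (simp add: gauss_dens_def)

lemma gauss_dens_measurable [measurable]: "gauss_dens \<in> borel_measurable borel"
  unfolding gauss_dens_def[abs_def] by measurable

lemma std_gaussian_eq: "std_gaussian = density lborel (\<lambda>x. ennreal (gauss_dens x))"
  by (simp add: std_gaussian_def gauss_dens_def)

lemma sets_std_gaussian [simp, measurable_cong]: "sets std_gaussian = sets borel"
  by (simp add: std_gaussian_def)

lemma space_std_gaussian [simp]: "space std_gaussian = UNIV"
  by (simp add: std_gaussian_def)

lemma nn_integral_std_gaussian:
  assumes [measurable]: "F \<in> borel_measurable borel"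
  shows "(\<integral>\<^sup>+x. F x \<partial>std_gaussian) = (\<integral>\<^sup>+x. ennreal (gauss_dens x) * F x \<partial>lborel)"
  unfolding std_gaussian_eq by (subst nn_integral_density) auto

lemma gauss_dens_prod:
  fixes x :: "real^'n"
  shows "gauss_dens x = (\<Prod>b\<in>Basis. std_normal_density (x \<bullet> b))"
proof -
  have "(norm x)\<^sup>2 = (\<Sum>b\<in>Basis. (x \<bullet> b)\<^sup>2)"
    by (subst power2_norm_eq_inner, subst euclidean_inner) (simp add: power2_eq_square)
  then have "exp (- (norm x)\<^sup>2 / 2) = (\<Prod>b\<in>Basis. exp (- (x \<bullet> b)\<^sup>2 / 2))"
    by (subst exp_sum[OF finite_Basis, symmetric]) (simp add: sum_negf sum_divide_distrib)
  moreover have "(2 * pi) powr (real CARD('n) / 2) = (\<Prod>b\<in>(Basis :: (real^'n) set). sqrt (2 * pi))"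
  proof -
    have "(\<Prod>b\<in>(Basis :: (real^'n) set). sqrt (2 * pi)) = sqrt (2 * pi) ^ CARD('n)"
      by (simp only: prod_constant) simp
    also have "\<dots> = sqrt (2 * pi) powr real CARD('n)"
      by (rule powr_realpow[symmetric]) simp
    also have "\<dots> = ((2 * pi) powr (1 / 2)) powr real CARD('n)"
      by (subst powr_half_sqrt) simp_all
    also have "\<dots> = (2 * pi) powr (real CARD('n) / 2)"
      by (simp only: powr_powr) simp
    finally show ?thesis by (rule sym)
  qed
  ultimately show ?thesis
    by (simp add: gauss_dens_def std_normal_density_def prod.distrib prod_dividef)
qed

lemma nn_integral_gauss_dens: "(\<integral>\<^sup>+x. ennreal (gauss_dens (x::real^'n)) \<partial>lborel) = 1"
proof -
  have "(\<integral>\<^sup>+x. ennreal (gauss_dens (x::real^'n)) \<partial>lborel) =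
      (\<integral>\<^sup>+x. (\<Prod>b\<in>(Basis :: (real^'n) set). ennreal (std_normal_density (x \<bullet> b))) \<partial>lborel)"
    unfolding gauss_dens_prod by (subst prod_ennreal) auto
  also have "\<dots> = (\<Prod>b\<in>(Basis :: (real^'n) set). \<integral>\<^sup>+x. ennreal (std_normal_density x) \<partial>lborel)"
    by (rule nn_integral_lborel_prod) auto
  also have "(\<integral>\<^sup>+x. ennreal (std_normal_density x) \<partial>lborel) = 1"
    using prob_space.emeasure_space_1[OF prob_space_normal_density[of 1 0]]
    by (simp add: emeasure_density)
  finally show ?thesis by simp
qed

lemma prob_space_std_gaussian: "prob_space (std_gaussian :: (real^'n) measure)"
  by (rule prob_spaceI) (simp add: std_gaussian_eq emeasure_density nn_integral_gauss_dens)

interpretation std_gaussian: prob_space "std_gaussian :: (real^'n) measure"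
  by (rule prob_space_std_gaussian)

lemma emeasure_std_gaussian_UNIV [simp]: "emeasure (std_gaussian :: (real^'n) measure) UNIV = 1"
  using std_gaussian.emeasure_space_1 by simp

lemma gauss_dens_norm_cong: "norm (x :: real^'n) = norm (y :: real^'n) \<Longrightarrow> gauss_dens x = gauss_dens y"
  by (simp add: gauss_dens_def)

text \<open>The density depends only on the norm. Applying the change of variables to the density
  itself, whose integral is 1, therefore forces the Jacobian constant to be 1.\<close>

lemma nn_integral_std_gaussian_orthogonal:
  fixes F :: "real^'n \<Rightarrow> ennreal"
  assumes g: "orthogonal_transformation (g :: real^'n \<Rightarrow> real^'n)" and [measurable]: "F \<in> borel_measurable borel"
  shows "(\<integral>\<^sup>+x. F (g x) \<partial>std_gaussian) = (\<integral>\<^sup>+x. F x \<partial>std_gaussian)"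
proof -
  have lin: "linear g" using g by (simp add: orthogonal_transformation_linear)
  then have [measurable]: "g \<in> borel_measurable borel"
    by (simp add: borel_measurable_continuous_onI linear_continuous_on linear_linear)
  obtain c where c: "c > 0" "\<And>F. F \<in> borel_measurable borel \<Longrightarrow>
       (\<integral>\<^sup>+x. F x \<partial>lborel) = ennreal c * (\<integral>\<^sup>+x. F (g x) \<partial>lborel)"
    using nn_integral_lborel_linear[OF lin orthogonal_transformation_bij[OF g]] by metis
  have e: "gauss_dens (g x) = gauss_dens x" for x
    by (rule gauss_dens_norm_cong) (simp add: orthogonal_transformation_norm[OF g])
  have "1 = ennreal c * 1"
    using c(2)[of "\<lambda>x. ennreal (gauss_dens x)"] by (simp add: e nn_integral_gauss_dens)
  then have "ennreal c = 1" by simp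
  then show ?thesis
    using c(2)[of "\<lambda>x. ennreal (gauss_dens x) * F x"] by (simp add: nn_integral_std_gaussian e)
qed

subsection \<open>Orthogonal projections\<close>

text \<open>Composing with this map on the whole space replaces the Gaussian measure of the
  subspace: the latter is the image of the full Gaussian measure under
  \<open>proj L\<close>.\<close>

definition proj :: "'a::euclidean_space set \<Rightarrow> 'a \<Rightarrow> 'a" where
  "proj L x = (SOME p. p \<in> L \<and> (\<forall>y\<in>L. orthogonal (x - p) y))"

lemma proj_exists:
  fixes L :: "'a::euclidean_space set"
  assumes "subspace L"
  shows "\<exists>p. p \<in> L \<and> (\<forall>y\<in>L. orthogonal (x - p) y)"
proof -
  obtain y z where yz: "y \<in> span L" "\<And>w. w \<in> span L \<Longrightarrow> orthogonal z w" "x = y + z"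
    using orthogonal_subspace_decomp_exists[of L x] by metis
  moreover have "span L = L" using assms by (simp add: span_eq_iff)
  ultimately show ?thesis by (intro exI[of _ y]) simp
qed

lemma proj_in: "subspace L \<Longrightarrow> proj L x \<in> L"
  and proj_orth: "subspace L \<Longrightarrow> y \<in> L \<Longrightarrow> (x - proj L x) \<bullet> y = 0"
  using someI_ex[OF proj_exists, of L x] unfolding proj_def orthogonal_def by blast+

lemma proj_unique:
  assumes "subspace L" "p \<in> L" "\<And>y. y \<in> L \<Longrightarrow> (x - p) \<bullet> y = 0"
  shows "proj L x = p"
proof -
  let ?d = "proj L x - p"
  have d: "?d \<in> L" using assms by (simp add: proj_in subspace_diff)
  have "?d \<bullet> ?d = (x - p) \<bullet> ?d - (x - proj L x) \<bullet> ?d"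
    by (simp add: inner_diff_left)
  also have "\<dots> = 0" using assms(3)[OF d] proj_orth[OF assms(1) d] by simp
  finally show ?thesis by simp
qed

lemma linear_proj: assumes "subspace L" shows "linear (proj L)"
proof (rule linearI)
  fix x y show "proj L (x + y) = proj L x + proj L y"
  proof (rule proj_unique[OF assms])
    show "proj L x + proj L y \<in> L" using assms by (simp add: proj_in subspace_add)
    show "(x + y - (proj L x + proj L y)) \<bullet> z = 0" if "z \<in> L" for z
      using proj_orth[OF assms that, of x] proj_orth[OF assms that, of y]
      by (simp add: inner_diff_left inner_add_left)
  qed
next
  fix r x show "proj L (r *\<^sub>R x) = r *\<^sub>R proj L x"
  proof (rule proj_unique[OF assms])
    show "r *\<^sub>R proj L x \<in> L" using assms by (simp add: proj_in subspace_scale)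
    show "(r *\<^sub>R x - r *\<^sub>R proj L x) \<bullet> z = 0" if "z \<in> L" for z
      using proj_orth[OF assms that, of x] by (simp add: inner_diff_left)
  qed
qed

lemma linear_borel_measurable: "linear f \<Longrightarrow> f \<in> borel_measurable borel"
  for f :: "'a::euclidean_space \<Rightarrow> 'b::euclidean_space"
  by (simp add: borel_measurable_continuous_onI linear_continuous_on linear_linear)

lemma proj_measurable [measurable]: "subspace L \<Longrightarrow> proj L \<in> borel_measurable borel"
  by (rule linear_borel_measurable[OF linear_proj])

lemma proj_id: "subspace L \<Longrightarrow> x \<in> L \<Longrightarrow> proj L x = x"
  by (rule proj_unique) auto

lemma proj_eq_0: "subspace L \<Longrightarrow> (\<And>y. y \<in> L \<Longrightarrow> x \<bullet> y = 0) \<Longrightarrow> proj L x = 0"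
  by (rule proj_unique) (auto simp: subspace_0)

lemma proj_orth_eq_0:
  assumes "subspace L" "subspace M" "\<And>x y. x \<in> L \<Longrightarrow> y \<in> M \<Longrightarrow> x \<bullet> y = 0"
  shows "proj L (proj M x) = 0"
  using assms proj_in by (intro proj_eq_0) (auto simp: inner_commute)

lemma norm_proj_Pythagoras:
  assumes "subspace L" shows "(norm x)\<^sup>2 = (norm (proj L x))\<^sup>2 + (norm (x - proj L x))\<^sup>2"
proof -
  have "orthogonal (proj L x) (x - proj L x)"
    using proj_orth[OF assms proj_in[OF assms], of x x] by (simp add: orthogonal_def inner_commute)
  from norm_add_Pythagorean[OF this] show ?thesis by simp
qed

lemma proj_orthogonal_image:
  assumes "subspace L" "orthogonal_transformation g"
  shows "proj (g ` L) (g x) = g (proj L x)"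
proof (rule proj_unique)
  have lin: "linear g" using assms by (simp add: orthogonal_transformation_linear)
  then show "subspace (g ` L)" using assms by (simp add: linear_subspace_image)
  show "g (proj L x) \<in> g ` L" using assms by (simp add: proj_in)
  fix y assume "y \<in> g ` L"
  then obtain z where z: "y = g z" "z \<in> L" by blast
  have "(g x - g (proj L x)) \<bullet> y = g (x - proj L x) \<bullet> g z"
    by (simp add: linear_diff[OF lin] z)
  also have "\<dots> = 0" using assms proj_orth z by (simp add: orthogonal_transformation_def)
  finally show "(g x - g (proj L x)) \<bullet> y = 0" .
qed

lemma subspace_orthogonal_complement: "subspace {y. \<forall>x\<in>S. x \<bullet> y = 0}"
  by (auto simp: subspace_def inner_add_right)

text \<open>The orthogonal complements have equal dimension too, so an isometry between the
  subspaces and one between the complements can be glued along the orthogonal decomposition.\<close>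

lemma orthogonal_transformation_subspaces_exists:
  fixes S T :: "'a::euclidean_space set"
  assumes S: "subspace S" and T: "subspace T" and d: "dim S = dim T"
  obtains g where "orthogonal_transformation g" "g ` S = T"
proof -
  let ?S = "{y. \<forall>x\<in>S. orthogonal x y}" and ?T = "{y. \<forall>x\<in>T. orthogonal x y}"
  have sub: "subspace ?S" "subspace ?T"
    using subspace_orthogonal_complement by (auto simp: orthogonal_def)
  have "dim ?S + dim S = DIM('a)" "dim ?T + dim T = DIM('a)"
    using dim_subspace_orthogonal_to_vectors[OF S subspace_UNIV] dim_subspace_orthogonal_to_vectors[OF T subspace_UNIV]
    by auto
  then have d': "dim ?S = dim ?T" using d by simp
  obtain f where f: "linear f" "f ` S = T" "\<And>x. x \<in> S \<Longrightarrow> norm (f x) = norm x"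
    by (rule isometries_subspaces[OF S T d]) (rule that)
  obtain h where h: "linear h" "h ` ?S = ?T" "\<And>x. x \<in> ?S \<Longrightarrow> norm (h x) = norm x"
    by (rule isometries_subspaces[OF sub d']) (rule that)
  define g where "g x = f (proj S x) + h (x - proj S x)" for x
  have "linear (\<lambda>x. f (proj S x))"
    using linear_compose[OF linear_proj[OF S] f(1)] unfolding o_def .
  moreover have l2: "linear (\<lambda>x. x - proj S x)"
    by (rule linear_compose_sub[OF linear_ident linear_proj[OF S]])
  have "linear (\<lambda>x. h (x - proj S x))"
    using linear_compose[OF l2 h(1)] unfolding o_def .
  ultimately have lin: "linear g"
    unfolding g_def[abs_def] by (rule linear_compose_add)
  have mem: "x - proj S x \<in> ?S" for x
    using proj_orth[OF S, of _ x] by (auto simp: orthogonal_def inner_commute[of _ "x - proj S x"])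
  have "norm (g x) = norm x" for x
  proof -
    have "f (proj S x) \<in> T" using f(2) proj_in[OF S] by blast
    moreover have "h (x - proj S x) \<in> ?T" using h(2) mem by blast
    ultimately have "orthogonal (f (proj S x)) (h (x - proj S x))" by blast
    from norm_add_Pythagorean[OF this]
    have "(norm (g x))\<^sup>2 = (norm (proj S x))\<^sup>2 + (norm (x - proj S x))\<^sup>2"
      using f(3)[OF proj_in[OF S]] h(3)[OF mem] by (simp add: g_def)
    also have "\<dots> = (norm x)\<^sup>2" by (rule norm_proj_Pythagoras[OF S, symmetric])
    finally show ?thesis by simp
  qed
  with lin have "orthogonal_transformation g" by (simp add: orthogonal_transformation)
  moreover have "g x = f x" if "x \<in> S" for x
    using that by (simp add: g_def proj_id[OF S] linear_0[OF h(1)])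
  then have "g ` S = T" using f(2) by (metis image_cong)
  ultimately show thesis by (rule that)
qed

section \<open>Independence of a projection and its complement\<close>

lemma nn_integral_lborel_shear_left:
  fixes T :: "'a::euclidean_space \<Rightarrow> 'b::euclidean_space"
  assumes [measurable]: "T \<in> borel_measurable borel" "case_prod H \<in> borel_measurable borel"
  shows "(\<integral>\<^sup>+y. \<integral>\<^sup>+x. H (x + T y) y \<partial>lborel \<partial>lborel) = (\<integral>\<^sup>+y. \<integral>\<^sup>+x. H x y \<partial>lborel \<partial>lborel)"
proof -
  have [measurable]: "(\<lambda>(x, y). H x y) \<in> borel_measurable (borel \<Otimes>\<^sub>M borel)"
    using assms(2) by (simp add: borel_prod)
  have "(\<integral>\<^sup>+x. H (x + T y) y \<partial>lborel) = (\<integral>\<^sup>+x. H x y \<partial>lborel)" for y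
    using nn_integral_lborel_translate[of "\<lambda>x. H x y" "T y"] by (simp add: add.commute)
  then show ?thesis by simp
qed

text \<open>An independent copy \<open>y\<close> is added, and a quarter turn between the complement
  parts of \<open>x\<close> and \<open>y\<close> puts that of \<open>y\<close> in the place of that
  of \<open>x\<close>. The turn is a product of three shears, each of which preserves Lebesgue
  measure by translation invariance, and it preserves the sum of the squared norms, hence the
  product of the two densities.\<close>

lemma nn_integral_std_gaussian_proj_indep:
  fixes L :: "(real^'n) set" and F :: "real^'n \<Rightarrow> real^'n \<Rightarrow> ennreal"
  assumes L: "subspace L" and F: "case_prod F \<in> borel_measurable borel"
  shows "(\<integral>\<^sup>+x. F (proj L x) (x - proj L x) \<partial>std_gaussian)
    = (\<integral>\<^sup>+x. \<integral>\<^sup>+y. F (proj L x) (y - proj L y) \<partial>std_gaussian \<partial>std_gaussian)"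
proof -
  have [measurable]: "(\<lambda>(x, y). F x y) \<in> borel_measurable (borel \<Otimes>\<^sub>M borel)"
    using F by (simp add: borel_prod)
  define T where "T x = x - proj L x" for x
  note lP = linear_proj[OF L]
  have [measurable]: "proj L \<in> borel_measurable borel" using L by simp
  have [measurable]: "T \<in> borel_measurable borel" unfolding T_def[abs_def] by measurable
  have T: "T (x + y) = T x + T y" "T (x - y) = T x - T y" "T (T x) = T x" "proj L (T x) = 0" for x y
    by (simp_all add: T_def linear_add[OF lP] linear_diff[OF lP] proj_id[OF L proj_in[OF L]])
  define H where "H x y = ennreal (gauss_dens x) * ennreal (gauss_dens y) * F (proj L x) (T x)" for x y :: "real^'n"
  have [measurable]: "case_prod H \<in> borel_measurable (borel \<Otimes>\<^sub>M borel)"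
    unfolding H_def[abs_def] by measurable
  have Hm: "case_prod H \<in> borel_measurable borel"
    using \<open>case_prod H \<in> borel_measurable (borel \<Otimes>\<^sub>M borel)\<close> by (simp add: borel_prod)
  have swap: "(\<integral>\<^sup>+y. \<integral>\<^sup>+x. K x y \<partial>lborel \<partial>lborel) = (\<integral>\<^sup>+x. \<integral>\<^sup>+y. K x y \<partial>lborel \<partial>lborel)"
    if [measurable]: "case_prod K \<in> borel_measurable (borel \<Otimes>\<^sub>M borel)" for K :: "real^'n \<Rightarrow> real^'n \<Rightarrow> ennreal"
    by (rule lborel_pair.Fubini') measurable
  have "(\<integral>\<^sup>+x. F (proj L x) (x - proj L x) \<partial>std_gaussian)
      = (\<integral>\<^sup>+x. (\<integral>\<^sup>+y. ennreal (gauss_dens (y::real^'n)) \<partial>lborel) * (ennreal (gauss_dens x) * F (proj L x) (T x)) \<partial>lborel)"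
    by (simp add: nn_integral_gauss_dens nn_integral_std_gaussian T_def)
  also have "\<dots> = (\<integral>\<^sup>+x. \<integral>\<^sup>+y. H x y \<partial>lborel \<partial>lborel)"
  proof (rule nn_integral_cong)
    fix x
    show "(\<integral>\<^sup>+y. ennreal (gauss_dens (y::real^'n)) \<partial>lborel) * (ennreal (gauss_dens x) * F (proj L x) (T x))
      = (\<integral>\<^sup>+y. H x y \<partial>lborel)"
      unfolding H_def by (subst nn_integral_multc[symmetric]) (simp_all add: mult_ac)
  qed
  also have "\<dots> = (\<integral>\<^sup>+y. \<integral>\<^sup>+x. H x y \<partial>lborel \<partial>lborel)"
    by (rule swap[symmetric]) measurable
  also have "\<dots> = (\<integral>\<^sup>+y. \<integral>\<^sup>+x. H (x + T y) y \<partial>lborel \<partial>lborel)"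
    by (rule nn_integral_lborel_shear_left[symmetric]) (use Hm in auto)
  also have "\<dots> = (\<integral>\<^sup>+x. \<integral>\<^sup>+y. H (x + T y) y \<partial>lborel \<partial>lborel)"
    by (rule swap) measurable
  also have "\<dots> = (\<integral>\<^sup>+x. \<integral>\<^sup>+y. H (x + T (y - T x)) (y - T x) \<partial>lborel \<partial>lborel)"
  proof (rule nn_integral_cong)
    fix x
    show "(\<integral>\<^sup>+y. H (x + T y) y \<partial>lborel) = (\<integral>\<^sup>+y. H (x + T (y - T x)) (y - T x) \<partial>lborel)"
      using nn_integral_lborel_translate[of "\<lambda>y. H (x + T y) y" "- T x"] by simp
  qed
  also have "\<dots> = (\<integral>\<^sup>+y. \<integral>\<^sup>+x. H (x + T (y - T x)) (y - T x) \<partial>lborel \<partial>lborel)"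
    by (rule swap[symmetric]) measurable
  also have "\<dots> = (\<integral>\<^sup>+y. \<integral>\<^sup>+x. H (proj L x + T y) (proj L y - T x) \<partial>lborel \<partial>lborel)"
  proof (rule nn_integral_cong)
    fix y
    have "(\<integral>\<^sup>+x. H (x + T (y - T x)) (y - T x) \<partial>lborel)
        = (\<integral>\<^sup>+x. H ((x + T y) + T (y - T (x + T y))) (y - T (x + T y)) \<partial>lborel)"
      using nn_integral_lborel_translate[of "\<lambda>x. H (x + T (y - T x)) (y - T x)" "T y"]
      by (simp add: add.commute)
    also have "\<dots> = (\<integral>\<^sup>+x. H (proj L x + T y) (proj L y - T x) \<partial>lborel)"
      by (rule nn_integral_cong) (simp add: T, simp add: T_def algebra_simps)
    finally show "(\<integral>\<^sup>+x. H (x + T (y - T x)) (y - T x) \<partial>lborel)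
        = (\<integral>\<^sup>+x. H (proj L x + T y) (proj L y - T x) \<partial>lborel)" .
  qed
  also have "\<dots> = (\<integral>\<^sup>+y. \<integral>\<^sup>+x. ennreal (gauss_dens x) * (ennreal (gauss_dens y) * F (proj L x) (T y)) \<partial>lborel \<partial>lborel)"
  proof (intro nn_integral_cong)
    fix x y :: "real^'n"
    have o: "orthogonal (proj L a) (T b)" "orthogonal (T b) (proj L a)" for a b
      using proj_orth[OF L proj_in[OF L], of b a] by (simp_all add: T_def orthogonal_def inner_commute)
    have "(norm (proj L x + T y))\<^sup>2 + (norm (proj L y - T x))\<^sup>2 = (norm x)\<^sup>2 + (norm y)\<^sup>2"
      using norm_add_Pythagorean[OF o(1), of x y] norm_add_Pythagorean[of "proj L y" "- T x"] o(1)[of y x]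
        norm_proj_Pythagoras[OF L, of x] norm_proj_Pythagoras[OF L, of y]
      by (simp add: T_def[symmetric] orthogonal_def)
    then have "gauss_dens (proj L x + T y) * gauss_dens (proj L y - T x) = gauss_dens x * gauss_dens y"
      by (simp add: gauss_dens_def exp_add[symmetric] add_divide_distrib[symmetric] del: exp_add)
    then have "ennreal (gauss_dens (proj L x + T y)) * ennreal (gauss_dens (proj L y - T x))
      = ennreal (gauss_dens x) * ennreal (gauss_dens y)"
      by (metis ennreal_mult gauss_dens_pos less_imp_le)
    then show "H (proj L x + T y) (proj L y - T x) = ennreal (gauss_dens x) * (ennreal (gauss_dens y) * F (proj L x) (T y))"
      by (simp add: H_def T linear_add[OF lP] proj_id[OF L proj_in[OF L]] mult_ac) (simp add: T_def proj_id[OF L proj_in[OF L]])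
  qed
  also have "\<dots> = (\<integral>\<^sup>+x. \<integral>\<^sup>+y. ennreal (gauss_dens x) * (ennreal (gauss_dens y) * F (proj L x) (T y)) \<partial>lborel \<partial>lborel)"
    by (rule swap) measurable
  also have "\<dots> = (\<integral>\<^sup>+x. \<integral>\<^sup>+y. F (proj L x) (y - proj L y) \<partial>std_gaussian \<partial>std_gaussian)"
    by (simp add: nn_integral_std_gaussian nn_integral_cmult T_def)
  finally show ?thesis .
qed

subsection \<open>Cones and the length of a projection\<close>

lemma AE_lborel_not_in_subspace:
  fixes V :: "'a::euclidean_space set"
  assumes "subspace V" "dim V < DIM('a)"
  shows "AE x in lborel. x \<notin> V"
proof -
  have "negligible V" using assms(2) by (rule negligible_lowdim)
  moreover have "V \<in> sets borel" using assms(1) by (simp add: closed_subspace borel_closed)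
  ultimately have "V \<in> null_sets lborel"
    by (simp add: negligible_iff_null_sets null_sets_def)
  then show ?thesis by (rule AE_not_in)
qed

lemma AE_std_gaussian:
  assumes "AE x in lborel. P x" shows "AE x in std_gaussian. P x"
  unfolding std_gaussian_eq using assms by (subst AE_density) auto

text \<open>On the level of Lebesgue measure, restricting the direction of the projection to a cone
  multiplies the distribution of its length by a constant, by scaling.\<close>

lemma nn_integral_std_gaussian_radial:
  fixes L C :: "(real^'n) set" and \<phi> :: "real \<Rightarrow> ennreal"
  assumes L: "subspace L" and [measurable]: "C \<in> sets borel"
    and cone: "\<And>r x. r > 0 \<Longrightarrow> x \<in> C \<Longrightarrow> r *\<^sub>R x \<in> C"
    and [measurable]: "\<phi> \<in> borel_measurable borel"
  shows "(\<integral>\<^sup>+x. indicator C (proj L x) * \<phi> (norm (proj L x)) \<partial>std_gaussian)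
    = emeasure std_gaussian {x. proj L x \<in> C} * (\<integral>\<^sup>+x. \<phi> (norm (proj L x)) \<partial>std_gaussian)"
proof (cases "L \<subseteq> {0}")
  \<comment> \<open>With \<open>L\<close> trivial the length is constantly 0. The case is separated
    because the scaling argument needs a projection that is nonzero almost everywhere.\<close>
  case True
  then have "proj L x = 0" for x using proj_in[OF L] by auto
  then show ?thesis
    by (cases "0 \<in> C") simp_all
next
  case False
  have [measurable]: "proj L \<in> borel_measurable borel" using L by simp
  have UB: "UNIV \<in> sets (borel :: (real^'n) measure)" by simp
  note lP = linear_proj[OF L]
  \<comment> \<open>This is the part of the Gaussian density transverse to \<open>L\<close>, up to
    normalisation. The part along \<open>L\<close> is withheld so that the resulting measures behave
    homogeneously under dilations of \<open>L\<close>.\<close>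
  define w where "w x = ennreal (exp (- (norm (x - proj L x))\<^sup>2 / 2))" for x :: "real^'n"
  have [measurable]: "w \<in> borel_measurable borel" unfolding w_def[abs_def] by measurable
  define N where "N S = distr (density lborel (\<lambda>x. indicator S (proj L x) * w x)) borel (\<lambda>x. norm (proj L x))"
    for S
  have N_int: "(\<integral>\<^sup>+t. \<psi> t \<partial>N S) = (\<integral>\<^sup>+x. indicator S (proj L x) * w x * \<psi> (norm (proj L x)) \<partial>lborel)"
    if [measurable]: "S \<in> sets borel" "\<psi> \<in> borel_measurable borel" for S \<psi>
    unfolding N_def by (simp add: nn_integral_distr nn_integral_density)
  have N_em: "emeasure (N S) B = (\<integral>\<^sup>+x. indicator S (proj L x) * w x * indicator B (norm (proj L x)) \<partial>lborel)"
    if [measurable]: "S \<in> sets borel" "B \<in> sets borel" for S B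
    using N_int[of S "indicator B"] that by (simp add: N_def)
  obtain e where e: "e \<in> L" "e \<noteq> 0" using False by blast
  have sk: "subspace {x. proj L x = 0}" by (rule linear_subspace_kernel[OF lP])
  have "e \<notin> span {x. proj L x = 0}"
    unfolding span_eq_iff[THEN iffD2, OF sk] using e proj_id[OF L e(1)] by simp
  then have "dim {x. proj L x = 0} \<noteq> DIM(real^'n)"
    by (metis UNIV_I dim_eq_full)
  then have "dim {x. proj L x = 0} < DIM(real^'n)"
    using dim_subset_UNIV[of "{x. proj L x = 0}"] by linarith
  then have ae: "AE x in lborel. proj L x \<noteq> 0"
    using AE_lborel_not_in_subspace[of "{x. proj L x = 0}"] sk by simp
  have nonpos: "emeasure (N S) {..r} = 0" if "r \<le> 0" and [measurable]: "S \<in> sets borel" for r S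
  proof -
    have "emeasure (N S) {..r} = nn_integral lborel (\<lambda>x::real^'n. 0)"
      unfolding N_em[OF that(2) atMost_borel]
    proof (rule nn_integral_cong_AE, use ae in eventually_elim)
      fix x assume "proj L x \<noteq> 0"
      then have "\<not> norm (proj L x) \<le> r" using that(1) by (meson norm_le_zero_iff order_trans)
      then show "indicator S (proj L x) * w x * indicator {..r} (norm (proj L x)) = 0" by simp
    qed
    then show ?thesis by simp
  qed
  \<comment> \<open>Proportionality of the two distribution functions in cross-multiplied form,
    which avoids dividing extended reals. For positive \<open>r\<close> both values at
    \<open>r\<close> are the same multiple of the values at 1.\<close>
  have scal: "emeasure (N C) {..r} * emeasure (N UNIV) {..1} = emeasure (N UNIV) {..r} * emeasure (N C) {..1}" for r
  proof (cases "r > 0")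
    case False
    then show ?thesis by (simp add: nonpos)
  next
    case r: True
    \<comment> \<open>The dilation acts along \<open>L\<close> only, so \<open>w\<close> is
      unchanged, and a cone is carried to itself.\<close>
    define A where "A x = r *\<^sub>R proj L x + (x - proj L x)" for x
    have lA: "linear A" unfolding A_def[abs_def]
      by (intro linear_compose_add linear_compose_scale_right linear_compose_sub lP linear_ident)
    have PA: "proj L (A x) = r *\<^sub>R proj L x" for x
      by (simp add: A_def linear_add[OF lP] linear_scale[OF lP] linear_diff[OF lP] proj_id[OF L proj_in[OF L]])
    have dA: "A x - proj L (A x) = x - proj L x" for x
      by (simp only: PA) (simp add: A_def)
    have "inj A"
    proof (rule linear_injective_0[THEN iffD2, OF lA], intro allI impI)
      fix x assume "A x = 0"
      then have "r *\<^sub>R proj L x = 0" using PA[of x] by (simp add: linear_0[OF lP])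
      then show "x = 0" using \<open>A x = 0\<close> r by (simp add: A_def)
    qed
    then have bA: "bij A" using linear_injective_imp_surjective[OF lA] by (simp add: bij_def)
    obtain c where c: "\<And>F. F \<in> borel_measurable borel \<Longrightarrow>
       (\<integral>\<^sup>+x. F x \<partial>lborel) = ennreal c * (\<integral>\<^sup>+x. F (A x) \<partial>lborel)"
      using nn_integral_lborel_linear[OF lA bA] by metis
    have "emeasure (N S) {..r} = ennreal c * emeasure (N S) {..1}"
      if [measurable]: "S \<in> sets borel" and S: "\<And>x. r *\<^sub>R x \<in> S \<longleftrightarrow> x \<in> S" for S
    proof -
      have "emeasure (N S) {..r} =
        ennreal c * (\<integral>\<^sup>+x. indicator S (proj L (A x)) * w (A x) * indicator {..r} (norm (proj L (A x))) \<partial>lborel)"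
        unfolding N_em[OF that(1) atMost_borel] by (rule c) measurable
      also have "(\<integral>\<^sup>+x. indicator S (proj L (A x)) * w (A x) * indicator {..r} (norm (proj L (A x))) \<partial>lborel)
         = emeasure (N S) {..1}"
        unfolding N_em[OF that(1) atMost_borel]
      proof (rule nn_integral_cong)
        fix x
        have "w (A x) = w x" by (simp only: w_def dA)
        moreover have "r * norm (proj L x) \<le> r \<longleftrightarrow> norm (proj L x) \<le> 1" using r by simp
        ultimately show "indicator S (proj L (A x)) * w (A x) * indicator {..r} (norm (proj L (A x)))
           = indicator S (proj L x) * w x * indicator {..1} (norm (proj L x))"
          using r by (simp add: PA S indicator_def)
      qed
      finally show ?thesis .
    qed
    note * = this
    have "r *\<^sub>R x \<in> C \<longleftrightarrow> x \<in> C" for x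
    proof
      assume "r *\<^sub>R x \<in> C"
      then show "x \<in> C" using cone[of "1/r" "r *\<^sub>R x"] r by simp
    qed (rule cone[OF r])
    then show ?thesis using *[of C] *[of UNIV] by (simp add: mult_ac)
  qed
  have mono: "emeasure (N C) B \<le> emeasure (N UNIV) B" if "B \<in> sets borel" for B
    unfolding N_em[OF \<open>C \<in> sets borel\<close> that] N_em[OF UB that]
    by (intro nn_integral_mono) (auto split: split_indicator)
  have fin: "emeasure (N UNIV) {..r} < \<infinity>" for r
  proof -
    \<comment> \<open>Where the length is at most \<open>r\<close>, restoring the density factor
      along \<open>L\<close> costs at most exp(r^2 / 2); the second factor undoes the Gaussian
      normalisation.\<close>
    define K where "K = exp (r\<^sup>2 / 2) * (2 * pi) powr (real CARD('n) / 2)"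
    have "emeasure (N UNIV) {..r} \<le> (\<integral>\<^sup>+x. ennreal K * ennreal (gauss_dens (x :: real^'n)) \<partial>lborel)"
      unfolding N_em[OF UB atMost_borel]
    proof (rule nn_integral_mono)
      fix x :: "real^'n"
      show "indicator UNIV (proj L x) * w x * indicator {..r} (norm (proj L x)) \<le> ennreal K * ennreal (gauss_dens x)"
      proof (cases "norm (proj L x) \<le> r")
        case True
        have "exp (- (norm (x - proj L x))\<^sup>2 / 2) = exp ((norm (proj L x))\<^sup>2 / 2) * exp (- (norm x)\<^sup>2 / 2)"
          using norm_proj_Pythagoras[OF L, of x] by (simp add: exp_add[symmetric] field_simps)
        also have "\<dots> \<le> exp (r\<^sup>2 / 2) * exp (- (norm x)\<^sup>2 / 2)"
          using True by (simp add: power_mono)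
        also have "\<dots> = K * gauss_dens x" by (simp add: K_def gauss_dens_def)
        finally show ?thesis using True
          by (simp add: w_def ennreal_mult[symmetric] K_def gauss_dens_pos less_imp_le ennreal_leI)
      qed simp
    qed
    also have "\<dots> = ennreal K" by (simp add: nn_integral_cmult nn_integral_gauss_dens)
    finally show ?thesis by (simp add: le_less_trans)
  qed
  have pos: "emeasure (N UNIV) {..1} \<noteq> 0"
  proof -
    \<comment> \<open>On the unit ball the transverse component has norm at most 1, so
      \<open>w\<close> is at least exp(-1/2) there.\<close>
    have "ennreal (exp (- 1 / 2)) * emeasure lborel (ball (0::real^'n) 1)
        = (\<integral>\<^sup>+x. ennreal (exp (- 1 / 2)) * indicator (ball (0::real^'n) 1) x \<partial>lborel)"
      by (rule nn_integral_cmult_indicator[symmetric]) simp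
    also have "\<dots> \<le> emeasure (N UNIV) {..1}"
      unfolding N_em[OF UB atMost_borel]
    proof (rule nn_integral_mono)
      fix x :: "real^'n"
      show "ennreal (exp (- 1 / 2)) * indicator (ball (0::real^'n) 1) x
        \<le> indicator UNIV (proj L x) * w x * indicator {..1} (norm (proj L x))"
      proof (cases "norm x < 1")
        case True
        then have "(norm x)\<^sup>2 \<le> 1" by (simp add: abs_square_le_1)
        then have "(norm (proj L x))\<^sup>2 \<le> 1" "(norm (x - proj L x))\<^sup>2 \<le> 1"
          using norm_proj_Pythagoras[OF L, of x] zero_le_power2[of "norm (proj L x)"]
            zero_le_power2[of "norm (x - proj L x)"] by linarith+
        then show ?thesis using True by (simp add: w_def abs_square_le_1 ennreal_leI)
      qed simp
    qed
    finally show ?thesis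
      using emeasure_lborel_open_pos[of "ball (0::real^'n) 1"] by auto
  qed
  have eq: "scale_measure (emeasure (N UNIV) {..1}) (N C) = scale_measure (emeasure (N C) {..1}) (N UNIV)"
  proof (rule measure_eqI_generator_eq[where E = "range (\<lambda>a::real. {..a})" and \<Omega> = UNIV and A = "\<lambda>n. {..real n}"])
    show "Int_stable (range (\<lambda>a::real. {..a}))" by (auto simp: Int_stable_def)
    show "sets (scale_measure (emeasure (N UNIV) {..1}) (N C)) = sigma_sets UNIV (range (\<lambda>a::real. {..a}))"
      "sets (scale_measure (emeasure (N C) {..1}) (N UNIV)) = sigma_sets UNIV (range (\<lambda>a::real. {..a}))"
      by (simp_all add: N_def borel_eq_atMost)
    show "(\<Union>i. {..real i}) = UNIV" by (auto intro: real_arch_simple)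
    show "emeasure (scale_measure (emeasure (N UNIV) {..1}) (N C)) X = emeasure (scale_measure (emeasure (N C) {..1}) (N UNIV)) X"
      if "X \<in> range (\<lambda>a::real. {..a})" for X
      using that scal by (auto simp: mult.commute)
    show "emeasure (scale_measure (emeasure (N UNIV) {..1}) (N C)) {..real i} \<noteq> \<infinity>" for i
      using fin[of 1] fin[of "real i"] mono[of "{..real i}"]
      by (auto simp: ennreal_mult_eq_top_iff top_unique less_top dest: le_less_trans)
  qed auto
  define a b where "a = emeasure (N UNIV) {..1}" and "b = emeasure (N C) {..1}"
  have ab: "a * (\<integral>\<^sup>+t. \<psi> t \<partial>N C) = b * (\<integral>\<^sup>+t. \<psi> t \<partial>N UNIV)" if "\<psi> \<in> borel_measurable borel" for \<psi>
    using arg_cong[OF eq, of "\<lambda>M. nn_integral M \<psi>"] that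
    by (simp add: nn_integral_scale_measure N_def a_def b_def)
  define k where "k = ennreal (1 / (2 * pi) powr (real CARD('n) / 2))"
  \<comment> \<open>The withheld factor of the density depends on the length alone, so it can be
    returned as part of the function integrated against \<open>N S\<close>.\<close>
  have dens: "(\<integral>\<^sup>+x. indicator S (proj L x) * \<psi> (norm (proj L x)) \<partial>std_gaussian) =
      (\<integral>\<^sup>+t. k * ennreal (exp (- t\<^sup>2 / 2)) * \<psi> t \<partial>N S)"
    if [measurable]: "S \<in> sets borel" "\<psi> \<in> borel_measurable borel" for S \<psi>
  proof -
    have "(\<integral>\<^sup>+x. indicator S (proj L x) * \<psi> (norm (proj L x)) \<partial>std_gaussian) =
      (\<integral>\<^sup>+x. ennreal (gauss_dens x) * (indicator S (proj L x) * \<psi> (norm (proj L x))) \<partial>lborel)"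
      by (rule nn_integral_std_gaussian) measurable
    also have "\<dots> = (\<integral>\<^sup>+x. indicator S (proj L x) * w x *
        (k * ennreal (exp (- (norm (proj L x))\<^sup>2 / 2)) * \<psi> (norm (proj L x))) \<partial>lborel)"
    proof (rule nn_integral_cong)
      fix x :: "real^'n"
      have "gauss_dens x = exp (- (norm (x - proj L x))\<^sup>2 / 2) * (1 / (2 * pi) powr (real CARD('n) / 2)) *
          exp (- (norm (proj L x))\<^sup>2 / 2)"
        using norm_proj_Pythagoras[OF L, of x] by (simp add: gauss_dens_def exp_add[symmetric] field_simps)
      then have "ennreal (gauss_dens x) = w x * k * ennreal (exp (- (norm (proj L x))\<^sup>2 / 2))"
        by (simp add: w_def k_def ennreal_mult[symmetric])
      then show "ennreal (gauss_dens x) * (indicator S (proj L x) * \<psi> (norm (proj L x))) =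
         indicator S (proj L x) * w x * (k * ennreal (exp (- (norm (proj L x))\<^sup>2 / 2)) * \<psi> (norm (proj L x)))"
        by (simp add: mult_ac)
    qed
    also have "\<dots> = (\<integral>\<^sup>+t. k * ennreal (exp (- t\<^sup>2 / 2)) * \<psi> t \<partial>N S)"
      by (rule N_int[symmetric]) measurable
    finally show ?thesis .
  qed
  have g1: "a * (\<integral>\<^sup>+x. indicator C (proj L x) * \<psi> (norm (proj L x)) \<partial>std_gaussian)
      = b * (\<integral>\<^sup>+x. \<psi> (norm (proj L x)) \<partial>std_gaussian)"
    if [measurable]: "\<psi> \<in> borel_measurable borel" for \<psi>
    using dens[of C \<psi>] dens[of UNIV \<psi>] ab[of "\<lambda>t. k * ennreal (exp (- t\<^sup>2 / 2)) * \<psi> t"] by simp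
  have "(\<integral>\<^sup>+x. indicator C (proj L x) \<partial>std_gaussian) = (\<integral>\<^sup>+x. indicator {x. proj L x \<in> C} x \<partial>std_gaussian)"
    by (rule nn_integral_cong) (simp add: indicator_def)
  also have "\<dots> = emeasure std_gaussian {x. proj L x \<in> C}"
    by (rule nn_integral_indicator) measurable
  \<comment> \<open>The constant test function 1 identifies the ratio of \<open>b\<close> to
    \<open>a\<close> as the Gaussian measure of the cone; afterwards \<open>a\<close> cancels, being
    positive and finite.\<close>
  finally have "a * emeasure std_gaussian {x. proj L x \<in> C} = b"
    using g1[of "\<lambda>_. 1"] by simp
  then have "a * (\<integral>\<^sup>+x. indicator C (proj L x) * \<phi> (norm (proj L x)) \<partial>std_gaussian)
     = a * (emeasure std_gaussian {x. proj L x \<in> C} * (\<integral>\<^sup>+x. \<phi> (norm (proj L x)) \<partial>std_gaussian))"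
    using g1[of \<phi>] by (simp flip: mult.assoc)
  moreover have "a \<noteq> 0" "a \<noteq> \<infinity>" using pos fin[of 1] by (simp_all add: a_def)
  ultimately show ?thesis by (simp add: ennreal_mult_cancel_left)
qed

subsection \<open>Gaussian measure of a sum of two cones\<close>

lemma minkowski_sum_subspace:
  "subspace L \<Longrightarrow> subspace M \<Longrightarrow> subspace (minkowski_sum L M)"
  unfolding minkowski_sum_def by (rule subspace_sums)

text \<open>With \<open>E = L + M\<close>, map \<open>E\<close> to itself by the identity on \<open>L\<close> and an isometry from
  the orthogonal complement of \<open>L\<close> in \<open>E\<close> onto \<open>M\<close>; only the existence of the
  (constant) Jacobian \<open>s\<close> is needed.\<close>

lemma emeasure_std_gaussian_minkowski_sum:
  fixes L M :: "(real^'n) set"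
  assumes L: "subspace L" and M: "subspace M" and LM: "L \<inter> M = {0}"
  obtains s :: real where "s > 0"
    "\<And>C D. C \<in> sets borel \<Longrightarrow> D \<in> sets borel \<Longrightarrow> C \<subseteq> L \<Longrightarrow> D \<subseteq> M \<Longrightarrow>
      emeasure std_gaussian {z. proj (minkowski_sum L M) z \<in> minkowski_sum C D} =
      ennreal s * (\<integral>\<^sup>+x. \<integral>\<^sup>+y. indicator C (proj L x) * indicator D (proj M y) *
         ennreal (exp (- (proj L x \<bullet> proj M y))) \<partial>std_gaussian \<partial>std_gaussian)"
proof -
  define E where "E = minkowski_sum L M"
  have E: "subspace E" unfolding E_def using L M by (rule minkowski_sum_subspace)
  have LE: "L \<subseteq> E" and ME: "M \<subseteq> E"
    unfolding E_def minkowski_sum_def using subspace_0[OF L] subspace_0[OF M]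
    by (force, force)
  define K where "K = {y \<in> E. \<forall>x\<in>L. orthogonal x y}"
  have K: "subspace K" unfolding K_def using E
    by (auto simp: subspace_def orthogonal_def inner_add_right)
  have "dim K + dim L = dim E"
    unfolding K_def by (rule dim_subspace_orthogonal_to_vectors[OF L E LE])
  moreover have "dim E + dim (L \<inter> M) = dim L + dim M"
    unfolding E_def minkowski_sum_def by (rule dim_sums_Int[OF L M])
  ultimately have "dim K = dim M" using LM by simp
  then obtain g where g: "orthogonal_transformation g" "g ` K = M"
    using orthogonal_transformation_subspaces_exists[OF K M] by metis
  have lg: "linear g" using g(1) by (rule orthogonal_transformation_linear)
  note lL = linear_proj[OF L] and lK = linear_proj[OF K] and lE = linear_proj[OF E]
  note pL = proj_in[OF L] and pK = proj_in[OF K] and pE = proj_in[OF E]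
  have KL: "x \<bullet> y = 0" if "x \<in> L" "y \<in> K" for x y
    using that by (auto simp: K_def orthogonal_def)
  have gK: "g (proj K x) \<in> M" for x using g(2) pK by blast
  have projE: "proj E x = proj L x + proj K x" for x
  proof (rule proj_unique[OF E])
    show "proj L x + proj K x \<in> E"
      using pL pK LE by (auto simp: K_def intro!: subspace_add[OF E])
    fix z assume z: "z \<in> E"
    have zK: "z - proj L z \<in> K"
      using z LE pL proj_orth[OF L, of _ z]
      by (auto simp: K_def orthogonal_def inner_commute[of _ "z - proj L z"] intro!: subspace_diff[OF E])
    have "(x - (proj L x + proj K x)) \<bullet> z =
      ((x - proj L x) \<bullet> proj L z - proj L z \<bullet> proj K x) +
      ((x - proj K x) \<bullet> (z - proj L z) - proj L x \<bullet> (z - proj L z))"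
      by (simp add: inner_diff_left inner_diff_right inner_add_left inner_commute[of "proj L z" "proj K x"])
    also have "\<dots> = 0"
      by (simp add: proj_orth[OF L pL] KL[OF pL pK] proj_orth[OF K zK] KL[OF pL zK])
    finally show "(x - (proj L x + proj K x)) \<bullet> z = 0" .
  qed
  \<comment> \<open>The last summand extends the map by the identity on the complement of
    \<open>E\<close>, giving a bijection of the whole space to which the change of variables
    applies.\<close>
  define A where "A x = proj L x + g (proj K x) + (x - proj E x)" for x
  have lA: "linear A"
  proof -
    have "linear (\<lambda>x. g (proj K x))"
      using linear_compose[OF lK lg] unfolding o_def .
    then show ?thesis unfolding A_def[abs_def]
      by (intro linear_compose_add linear_compose_sub lL lE linear_ident)
  qed
  have projA: "proj E (A x) = proj L x + g (proj K x)" for x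
  proof (rule proj_unique[OF E])
    show "proj L x + g (proj K x) \<in> E"
      using pL gK LE ME by (auto intro!: subspace_add[OF E])
    show "(A x - (proj L x + g (proj K x))) \<bullet> z = 0" if "z \<in> E" for z
      using proj_orth[OF E that, of x] by (simp add: A_def)
  qed
  have dA: "A x - proj E (A x) = x - proj E x" for x
    by (simp only: projA) (simp add: A_def)
  \<comment> \<open>\<open>L\<close> and \<open>M\<close> need not be orthogonal, so
    \<open>A\<close> is not an isometry. The inner product of the two parts is the whole deviation,
    and in the density it becomes the exponential kernel.\<close>
  have nA: "(norm (A x))\<^sup>2 = (norm x)\<^sup>2 + 2 * (proj L x \<bullet> g (proj K x))" for x
  proof -
    have gn: "g (proj K x) \<bullet> g (proj K x) = proj K x \<bullet> proj K x"
      using g(1) by (simp add: orthogonal_transformation_def)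
    have "(norm (A x))\<^sup>2 = (norm (proj L x + g (proj K x)))\<^sup>2 + (norm (x - proj E x))\<^sup>2"
      using norm_proj_Pythagoras[OF E, of "A x"] by (simp only: dA) (simp only: projA)
    also have "(norm (proj L x + g (proj K x)))\<^sup>2 = (norm (proj E x))\<^sup>2 + 2 * (proj L x \<bullet> g (proj K x))"
      unfolding projE power2_norm_eq_inner
      using gn KL[OF pL pK, of x x]
      by (simp add: inner_add_left inner_add_right inner_commute)
    finally show ?thesis using norm_proj_Pythagoras[OF E, of x] by simp
  qed
  have dens: "gauss_dens (A x) = gauss_dens x * exp (- (proj L x \<bullet> g (proj K x)))" for x
    unfolding gauss_dens_def nA by (simp add: exp_add[symmetric] field_simps)
  have split: "u = u' \<and> v = v'" if "u + v = u' + v'" "u \<in> L" "u' \<in> L" "v \<in> M" "v' \<in> M" for u v u' v'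
  proof -
    have "u - u' = v' - v" using that(1) by (simp add: algebra_simps)
    moreover have "u - u' \<in> L" "v' - v \<in> M" using that L M by (simp_all add: subspace_diff)
    ultimately have "u - u' \<in> L \<inter> M" by auto
    then show ?thesis using LM \<open>u - u' = v' - v\<close> by auto
  qed
  have "inj A"
  proof (rule linear_injective_0[THEN iffD2, OF lA], intro allI impI)
    fix x assume "A x = 0"
    then have "proj L x + g (proj K x) = 0 + 0" using projA[of x] by (simp add: linear_0[OF lE])
    then have *: "proj L x = 0" "g (proj K x) = 0"
      using split pL gK subspace_0[OF L] subspace_0[OF M] by blast+
    then have "norm (proj K x) = 0" using orthogonal_transformation_norm[OF g(1), of "proj K x"] by simp
    then show "x = 0" using \<open>A x = 0\<close> * by (simp add: A_def projE)
  qed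
  then have bA: "bij A" using linear_injective_imp_surjective[OF lA] by (simp add: bij_def)
  obtain B where B: "linear B" "\<And>x. B (A x) = x" "\<And>x. A (B x) = x"
    by (metis \<open>inj A\<close> lA linear_injective_isomorphism)
  obtain s where s: "s > 0" "\<And>F. F \<in> borel_measurable borel \<Longrightarrow>
       (\<integral>\<^sup>+x. F x \<partial>lborel) = ennreal s * (\<integral>\<^sup>+x. F (A x) \<partial>lborel)"
    using nn_integral_lborel_linear[OF lA bA] by metis
  have [measurable]: "proj L \<in> borel_measurable borel" "proj K \<in> borel_measurable borel"
    "proj E \<in> borel_measurable borel" "proj M \<in> borel_measurable borel"
    "g \<in> borel_measurable borel" "A \<in> borel_measurable borel" "B \<in> borel_measurable borel"
    using L K E M lg lA B(1) by (simp_all add: linear_borel_measurable)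
  show thesis
  proof (rule that[OF s(1)])
    fix C D :: "(real^'n) set"
    assume [measurable]: "C \<in> sets borel" "D \<in> sets borel" and CL: "C \<subseteq> L" and DM: "D \<subseteq> M"
    let ?S = "{z. proj E z \<in> minkowski_sum C D}"
    have iff: "A x \<in> ?S \<longleftrightarrow> proj L x \<in> C \<and> g (proj K x) \<in> D" for x
    proof
      assume "A x \<in> ?S"
      then obtain u v where uv: "proj L x + g (proj K x) = u + v" "u \<in> C" "v \<in> D"
        unfolding mem_Collect_eq projA minkowski_sum_def by blast
      then have "proj L x = u \<and> g (proj K x) = v"
        using split[OF uv(1)] pL gK CL DM by blast
      then show "proj L x \<in> C \<and> g (proj K x) \<in> D" using uv by simp
    next
      assume "proj L x \<in> C \<and> g (proj K x) \<in> D"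
      then show "A x \<in> ?S" unfolding mem_Collect_eq projA minkowski_sum_def by blast
    qed
    \<comment> \<open>Describing the event through the inverse \<open>B\<close> gives its
      measurability directly from \<open>C\<close> and \<open>D\<close>, without a topological
      property of their sum.\<close>
    have "?S = {z. proj L (B z) \<in> C \<and> g (proj K (B z)) \<in> D}"
      using iff[of "B _"] by (simp add: B(3) set_eq_iff)
    moreover have "{z \<in> space borel. proj L (B z) \<in> C \<and> g (proj K (B z)) \<in> D} \<in> sets borel"
      by measurable
    ultimately have S[measurable]: "?S \<in> sets borel" by simp
    define F where "F u v = indicator C u * indicator D (g (proj K v)) * ennreal (exp (- (u \<bullet> g (proj K v))))"
      for u v
    have "(\<lambda>(u, v). F u v) \<in> borel_measurable (borel \<Otimes>\<^sub>M borel)"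
      unfolding F_def by measurable
    then have Fm: "case_prod F \<in> borel_measurable borel" by (simp add: borel_prod)
    have Fm': "(\<lambda>x. F (proj L x) (x - proj L x)) \<in> borel_measurable borel"
      unfolding F_def by measurable
    have KP: "proj K (proj L x) = 0" for x
      by (rule proj_orth_eq_0[OF K L]) (metis KL inner_commute)
    have "emeasure std_gaussian ?S = (\<integral>\<^sup>+z. indicator ?S z \<partial>std_gaussian)"
      by (rule nn_integral_indicator[symmetric]) simp
    also have "\<dots> = (\<integral>\<^sup>+z. ennreal (gauss_dens z) * indicator ?S z \<partial>lborel)"
      by (rule nn_integral_std_gaussian) measurable
    also have "\<dots> = ennreal s * (\<integral>\<^sup>+x. ennreal (gauss_dens (A x)) * indicator ?S (A x) \<partial>lborel)"
      by (rule s(2)) measurable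
    also have "(\<integral>\<^sup>+x. ennreal (gauss_dens (A x)) * indicator ?S (A x) \<partial>lborel) =
       (\<integral>\<^sup>+x. ennreal (gauss_dens x) * F (proj L x) (x - proj L x) \<partial>lborel)"
    proof (rule nn_integral_cong)
      fix x
      have "indicator ?S (A x) = (indicator C (proj L x) * indicator D (g (proj K x)) :: ennreal)"
        using iff[of x] by (simp add: indicator_def)
      then show "ennreal (gauss_dens (A x)) * indicator ?S (A x) =
        ennreal (gauss_dens x) * F (proj L x) (x - proj L x)"
        by (simp add: dens F_def linear_diff[OF lK] KP ennreal_mult gauss_dens_pos less_imp_le mult_ac)
    qed
    also have "\<dots> = (\<integral>\<^sup>+x. F (proj L x) (x - proj L x) \<partial>std_gaussian)"
      by (rule nn_integral_std_gaussian[symmetric]) (rule Fm')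
    also have "\<dots> = (\<integral>\<^sup>+x. \<integral>\<^sup>+y. F (proj L x) (y - proj L y) \<partial>std_gaussian \<partial>std_gaussian)"
      by (rule nn_integral_std_gaussian_proj_indep[OF L Fm])
    also have "\<dots> = (\<integral>\<^sup>+x. \<integral>\<^sup>+y. indicator C (proj L x) * indicator D (proj M y) *
         ennreal (exp (- (proj L x \<bullet> proj M y))) \<partial>std_gaussian \<partial>std_gaussian)"
    proof (rule nn_integral_cong)
      fix x :: "real^'n"
      let ?H = "\<lambda>y. indicator C (proj L x) * indicator D (proj M y) * ennreal (exp (- (proj L x \<bullet> proj M y)))"
      \<comment> \<open>Since \<open>g\<close> carries \<open>K\<close> onto \<open>M\<close>, it
        intertwines the two projections; rotating \<open>y\<close> by \<open>g\<close> then turns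
        the integral over \<open>K\<close> into one over \<open>M\<close>.\<close>
      have "F (proj L x) (y - proj L y) = ?H (g y)" for y
        using proj_orthogonal_image[OF K g(1), of y]
        by (simp add: F_def linear_diff[OF lK] KP g(2))
      then have "(\<integral>\<^sup>+y. F (proj L x) (y - proj L y) \<partial>std_gaussian) = (\<integral>\<^sup>+y. ?H (g y) \<partial>std_gaussian)"
        by simp
      also have "\<dots> = (\<integral>\<^sup>+y. ?H y \<partial>std_gaussian)"
        by (rule nn_integral_std_gaussian_orthogonal[OF g(1)]) measurable
      finally show "(\<integral>\<^sup>+y. F (proj L x) (y - proj L y) \<partial>std_gaussian) = (\<integral>\<^sup>+y. ?H y \<partial>std_gaussian)" .
    qed
    finally show "emeasure std_gaussian {z. proj (minkowski_sum L M) z \<in> minkowski_sum C D} =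
      ennreal s * (\<integral>\<^sup>+x. \<integral>\<^sup>+y. indicator C (proj L x) * indicator D (proj M y) *
         ennreal (exp (- (proj L x \<bullet> proj M y))) \<partial>std_gaussian \<partial>std_gaussian)"
      unfolding E_def .
  qed
qed

subsection \<open>Haar measure on the rotation group\<close>

lemma measurable_matrix_vector_mult [measurable (raw)]:
  assumes [measurable]: "f \<in> M \<rightarrow>\<^sub>M borel" "g \<in> M \<rightarrow>\<^sub>M borel"
  shows "(\<lambda>x. (f x :: real^'n^'m) *v g x) \<in> borel_measurable M"
proof -
  have "continuous_on UNIV (\<lambda>p :: (real^'n^'m) \<times> (real^'n). fst p *v snd p)"
    unfolding matrix_vector_mult_def by (intro continuous_intros)
  then have "(\<lambda>p :: (real^'n^'m) \<times> (real^'n). fst p *v snd p) \<in> borel \<Otimes>\<^sub>M borel \<rightarrow>\<^sub>M borel"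
    by (simp add: borel_prod borel_measurable_continuous_onI)
  from measurable_compose[OF measurable_Pair[OF assms] this] show ?thesis by simp
qed

lemma measurable_matrix_matrix_mult [measurable (raw)]:
  assumes [measurable]: "f \<in> M \<rightarrow>\<^sub>M borel" "g \<in> M \<rightarrow>\<^sub>M borel"
  shows "(\<lambda>x. (f x :: real^'n^'m) ** (g x :: real^'k^'n)) \<in> borel_measurable M"
proof -
  have "continuous_on UNIV (\<lambda>p :: (real^'n^'m) \<times> (real^'k^'n). fst p ** snd p)"
    unfolding matrix_matrix_mult_def by (intro continuous_intros)
  then have "(\<lambda>p :: (real^'n^'m) \<times> (real^'k^'n). fst p ** snd p) \<in> borel \<Otimes>\<^sub>M borel \<rightarrow>\<^sub>M borel"
    by (simp add: borel_prod borel_measurable_continuous_onI)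
  from measurable_compose[OF measurable_Pair[OF assms] this] show ?thesis by simp
qed

lemma measurable_transpose [measurable (raw)]:
  assumes [measurable]: "f \<in> M \<rightarrow>\<^sub>M borel"
  shows "(\<lambda>x. transpose (f x :: real^'n^'m)) \<in> borel_measurable M"
proof -
  have "continuous_on UNIV (\<lambda>p :: real^'n^'m. transpose p)"
    unfolding transpose_def by (intro continuous_intros)
  then have "(\<lambda>p :: real^'n^'m. transpose p) \<in> borel \<rightarrow>\<^sub>M borel"
    by (simp add: borel_measurable_continuous_onI)
  from measurable_compose[OF assms this] show ?thesis by simp
qed

lemma SO_mult: "Q \<in> SO \<Longrightarrow> R \<in> SO \<Longrightarrow> Q ** R \<in> SO"
  by (simp add: SO_def orthogonal_matrix_mul det_mul)

lemma SO_transpose: "Q \<in> SO \<Longrightarrow> transpose Q \<in> SO"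
  by (simp add: SO_def orthogonal_matrix_transpose)

lemma SO_transpose_mult: "Q \<in> SO \<Longrightarrow> transpose Q ** Q = mat 1" "Q \<in> SO \<Longrightarrow> Q ** transpose Q = mat 1"
  by (auto simp: SO_def orthogonal_matrix_def)

lemma SO_orthogonal_transformation: "Q \<in> SO \<Longrightarrow> orthogonal_transformation ((*v) Q)"
  by (simp add: SO_def orthogonal_transformation_matrix)

lemma closed_SO: "closed (SO :: (real^'n^'n) set)"
proof -
  have eq: "SO = {Q :: real^'n^'n. transpose Q ** Q = mat 1} \<inter> {Q. det Q = 1}"
    by (auto simp: SO_def orthogonal_matrix)
  have "closed {Q :: real^'n^'n. transpose Q ** Q = mat 1}"
    unfolding matrix_matrix_mult_def transpose_def
    by (intro closed_Collect_eq continuous_intros)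
  moreover have "closed {Q :: real^'n^'n. det Q = 1}"
    unfolding Determinants.det_def by (intro closed_Collect_eq continuous_intros)
  ultimately show ?thesis unfolding eq by (rule closed_Int)
qed

lemma rot_mult: "rot (Q ** R) D = rot Q (rot R D)"
  by (simp add: rot_def image_image matrix_vector_mul_assoc)

lemma subspace_rot: "subspace M \<Longrightarrow> subspace (rot Q M)"
  unfolding rot_def by (rule linear_subspace_image) simp_all

section \<open>Reflections and transitivity of rotations on spheres\<close>

definition reflection :: "'a::real_inner \<Rightarrow> 'a \<Rightarrow> 'a" where
  "reflection a x = x - (2 * (x \<bullet> a) / (a \<bullet> a)) *\<^sub>R a"

lemma orthogonal_transformation_reflection:
  assumes "a \<noteq> 0" shows "orthogonal_transformation (reflection a)"
  unfolding orthogonal_transformation_def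
proof (intro conjI allI)
  show "linear (reflection a)"
    by (rule linearI) (auto simp: reflection_def inner_add_left algebra_simps add_divide_distrib)
  fix v w
  have "a \<bullet> a \<noteq> 0" using assms by simp
  then show "reflection a v \<bullet> reflection a w = v \<bullet> w"
    by (simp add: reflection_def inner_diff_left inner_diff_right inner_commute field_simps)
qed

lemma orthogonal_transformation_reflection_conj:
  assumes "orthogonal_transformation g"
  shows "reflection (g a) (g x) = g (reflection a x)"
  using assms orthogonal_transformation_linear[OF assms]
  by (simp add: reflection_def orthogonal_transformation_def linear_diff linear_scale)

lemma reflection_scaleR: "c \<noteq> 0 \<Longrightarrow> reflection (c *\<^sub>R a) = reflection a"
  by (rule ext) (simp add: reflection_def)

lemma reflection_swap:
  assumes "norm x = norm y" "x \<noteq> y" shows "reflection (x - y) x = y"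
proof -
  have "x \<bullet> x = y \<bullet> y" using assms(1) by (simp add: norm_eq)
  then have h: "(x - y) \<bullet> (x - y) = 2 * (x \<bullet> (x - y))"
    by (simp add: inner_diff_left inner_diff_right inner_commute)
  have "x \<bullet> (x - y) \<noteq> 0"
  proof
    assume "x \<bullet> (x - y) = 0"
    with h have "(x - y) \<bullet> (x - y) = 0" by simp
    then show False using assms(2) by simp
  qed
  then have e: "2 * (x \<bullet> (x - y)) / ((x - y) \<bullet> (x - y)) = 1" 
    unfolding h by (metis divide_self mult_eq_0_iff zero_neq_numeral)
  show ?thesis unfolding reflection_def e by simp
qed

text \<open>Rescaling the normal vector does not change a reflection, and vectors of equal norm are
  exchanged by an orthogonal map; hence any two reflections are conjugate.\<close>

lemma det_reflection_eq:
  fixes a b :: "real^'n"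
  assumes "a \<noteq> 0" "b \<noteq> 0"
  shows "det (matrix (reflection a)) = det (matrix (reflection b))"
proof -
  define b' where "b' = (norm a / norm b) *\<^sub>R b"
  have "norm a = norm b'" using assms by (simp add: b'_def)
  then obtain g where g: "orthogonal_transformation g" "g a = b'"
    by (rule orthogonal_transformation_exists)
  have b': "reflection b' = reflection b" unfolding b'_def using assms by (intro reflection_scaleR) simp
  have "reflection b \<circ> g = g \<circ> reflection a"
    using orthogonal_transformation_reflection_conj[OF g(1), of a] by (auto simp: g(2) b')
  then have "matrix (reflection b) ** matrix g = matrix g ** matrix (reflection a)"
    using assms g(1) orthogonal_transformation_reflection
    by (metis matrix_compose orthogonal_transformation_linear)
  then have "det (matrix (reflection b)) * det (matrix g) = det (matrix g) * det (matrix (reflection a))"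
    by (metis det_mul)
  moreover have "det (matrix g) \<noteq> 0"
    using g(1) det_orthogonal_matrix[of "matrix g"] by (auto simp: orthogonal_transformation_matrix)
  ultimately show ?thesis by simp
qed

text \<open>A product of two reflections, so the determinant is \<open>1\<close> whatever the determinant of
  a reflection is.\<close>

lemma SO_transitive:
  fixes x y w :: "real^'n"
  assumes xy: "norm x = norm y" and w: "w \<noteq> 0" "x \<bullet> w = 0" "y \<bullet> w = 0"
  obtains Q where "Q \<in> SO" "Q *v x = y" "\<And>z. z \<bullet> w = 0 \<Longrightarrow> \<exists>c. Q *v z = z + c *\<^sub>R (x - y)"
    "\<And>z. z \<bullet> w = 0 \<Longrightarrow> z \<bullet> (x - y) = 0 \<Longrightarrow> Q *v z = z"
proof (cases "x = y")
  case True
  show thesis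
    by (rule that[of "mat 1"]) (use True in \<open>auto simp: SO_def orthogonal_matrix_id intro: exI[of _ 0]\<close>)
next
  case False
  \<comment> \<open>\<open>?r\<close> does the work of taking \<open>x\<close> to \<open>y\<close>.
    \<open>?s\<close> fixes everything orthogonal to \<open>w\<close>, in particular
    \<open>x\<close> and \<open>y\<close>, and serves only to correct the determinant.\<close>
  let ?r = "reflection (x - y)" and ?s = "reflection w"
  have o: "orthogonal_transformation ?r" "orthogonal_transformation ?s"
    using False w by (simp_all add: orthogonal_transformation_reflection)
  have lin: "linear ?r" "linear ?s" using o by (simp_all add: orthogonal_transformation_linear)
  define Q where "Q = matrix ?r ** matrix ?s"
  have Q: "Q *v z = ?r (?s z)" for z
    by (simp add: Q_def flip: matrix_vector_mul_assoc) (simp add: matrix_works lin linear_linear matrix_vector_mul)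
  have s: "?s z = z" if "z \<bullet> w = 0" for z using that by (simp add: reflection_def)
  have om: "orthogonal_matrix (matrix ?r)" "orthogonal_matrix (matrix ?s)"
    using o by (simp_all add: orthogonal_transformation_matrix)
  have "det Q = det (matrix ?r) * det (matrix ?r)"
    using False w by (simp add: Q_def det_mul det_reflection_eq[of w "x - y"])
  also have "\<dots> = 1" using det_orthogonal_matrix[OF om(1)] by auto
  finally have "Q \<in> SO" using om by (simp add: SO_def Q_def orthogonal_matrix_mul)
  moreover have "Q *v x = y" using s[OF w(2)] reflection_swap[OF xy False] by (simp add: Q)
  moreover have "\<exists>c. Q *v z = z + c *\<^sub>R (x - y)" if "z \<bullet> w = 0" for z
    unfolding Q s[OF that] by (rule exI[of _ "- (2 * (z \<bullet> (x - y)) / ((x - y) \<bullet> (x - y)))"]) (simp only: reflection_def scaleR_minus_left diff_conv_add_uminus)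
  moreover have "Q *v z = z" if "z \<bullet> w = 0" "z \<bullet> (x - y) = 0" for z
    unfolding Q s[OF that(1)] using that(2) by (simp add: reflection_def)
  ultimately show thesis by (rule that)
qed

text \<open>The measure lives on all matrices, with membership in \<open>SO\<close> only almost
  sure. Measurability can then be checked against the Borel sets of the full matrix space, and
  invariance is available for integrals.\<close>

locale haar_rotation = prob_space mu for mu :: "(real^'n^'n) measure" +
  assumes sets_mu [simp, measurable_cong]: "sets mu = sets borel"
    and AE_SO: "AE \<theta> in mu. \<theta> \<in> SO"
    and left_invariant: "\<And>Q F. Q \<in> SO \<Longrightarrow> F \<in> borel_measurable borel \<Longrightarrow>
      (\<integral>\<^sup>+\<theta>. F (Q ** \<theta>) \<partial>mu) = (\<integral>\<^sup>+\<theta>. F \<theta> \<partial>mu)"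

lemma haar_rotation_distr:
  assumes "haar_SO (nu :: (real^'n^'n) measure)"
  shows "haar_rotation (distr nu borel (\<lambda>x. x))" and "(\<lambda>x. x) \<in> nu \<rightarrow>\<^sub>M borel"
proof -
  interpret nu: prob_space nu using assms by (simp add: haar_SO_def)
  have sp: "space nu = SO" and se: "sets nu = sets (restrict_space borel SO)"
    and inv: "\<And>Q A. Q \<in> SO \<Longrightarrow> A \<in> sets nu \<Longrightarrow> emeasure nu ((\<lambda>R. Q ** R) ` A) = emeasure nu A"
    using assms by (auto simp: haar_SO_def)
  show id [measurable]: "(\<lambda>x. x) \<in> nu \<rightarrow>\<^sub>M borel"
    using measurable_restrict_space1[of "\<lambda>x. x" borel borel SO] measurable_cong_sets[OF se refl] by auto
  have SOb [measurable]: "SO \<in> sets (borel :: (real^'n^'n) measure)" by (rule borel_closed[OF closed_SO])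
  show "haar_rotation (distr nu borel (\<lambda>x. x))"
  proof (intro haar_rotation.intro haar_rotation_axioms.intro)
    show "prob_space (distr nu borel (\<lambda>x. x))" by (rule nu.prob_space_distr) measurable
    show "AE \<theta> in distr nu borel (\<lambda>x. x). \<theta> \<in> SO"
      by (subst AE_distr_iff) (use sp in auto)
    fix Q :: "real^'n^'n" and F :: "real^'n^'n \<Rightarrow> ennreal"
    assume Q: "Q \<in> SO" and [measurable]: "F \<in> borel_measurable borel"
    have mQ [measurable]: "(\<lambda>R. Q ** R) \<in> nu \<rightarrow>\<^sub>M nu"
    proof (subst measurable_cong_sets[OF refl se], rule measurable_restrict_space2)
      show "(\<lambda>R. Q ** R) \<in> space nu \<rightarrow> SO" using sp SO_mult[OF Q] by auto
    qed measurable
    have "distr nu nu (\<lambda>R. Q ** R) = nu"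
    proof (rule measure_eqI)
      fix A assume "A \<in> sets (distr nu nu (\<lambda>R. Q ** R))"
      then have A: "A \<in> sets nu" by simp
      then have AS: "A \<subseteq> SO" using sets.sets_into_space[OF A] sp by simp
      \<comment> \<open>Invariance of \<open>nu\<close> is given for images of sets while the
        push-forward involves preimages. Left translation is surjective on \<open>SO\<close>, so
        \<open>A\<close> is the image of its own preimage.\<close>
      let ?B = "(\<lambda>R. Q ** R) -` A \<inter> space nu"
      have "(\<lambda>R. Q ** R) ` ?B = A"
      proof safe
        fix R assume R: "R \<in> A"
        have "Q ** (transpose Q ** R) = R"
          by (simp add: matrix_mul_assoc SO_transpose_mult[OF Q])
        moreover have "transpose Q ** R \<in> SO" using R AS Q by (intro SO_mult SO_transpose) auto
        ultimately show "R \<in> (\<lambda>R. Q ** R) ` ?B" using R sp by (intro image_eqI[of _ _ "transpose Q ** R"]) auto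
      qed
      then show "emeasure (distr nu nu (\<lambda>R. Q ** R)) A = emeasure nu A"
        using inv[OF Q measurable_sets[OF mQ A]] A by (simp add: emeasure_distr)
    qed simp
    then have "(\<integral>\<^sup>+\<theta>. F \<theta> \<partial>nu) = (\<integral>\<^sup>+\<theta>. F \<theta> \<partial>distr nu nu (\<lambda>R. Q ** R))" by simp
    also have "\<dots> = (\<integral>\<^sup>+\<theta>. F (Q ** \<theta>) \<partial>nu)" by (rule nn_integral_distr) measurable
    finally show "(\<integral>\<^sup>+\<theta>. F (Q ** \<theta>) \<partial>distr nu borel (\<lambda>x. x)) = (\<integral>\<^sup>+\<theta>. F \<theta> \<partial>distr nu borel (\<lambda>x. x))"
      by (simp add: nn_integral_distr)
  qed simp
qed

section \<open>Inversion and right invariance of the Haar measure\<close>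

context haar_rotation
begin

text \<open>Average F(\<eta>^T \<theta>) over two independent rotations. Left invariance in
  \<open>\<theta>\<close> removes \<open>\<eta>\<close>; in the other order, substituting
  \<open>\<theta> ** \<eta>\<close> for \<open>\<eta>\<close> removes \<open>\<theta>\<close> and
  leaves the transpose.\<close>

lemma transpose_invariant:
  assumes [measurable]: "F \<in> borel_measurable borel"
  shows "(\<integral>\<^sup>+\<theta>. F (transpose \<theta>) \<partial>mu) = (\<integral>\<^sup>+\<theta>. F \<theta> \<partial>mu)"
proof -
  interpret P: pair_sigma_finite mu mu ..
  have "(\<integral>\<^sup>+\<theta>. F \<theta> \<partial>mu) = (\<integral>\<^sup>+\<eta>. (\<integral>\<^sup>+\<theta>. F \<theta> \<partial>mu) \<partial>mu)"
    by (simp add: emeasure_space_1)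
  also have "\<dots> = (\<integral>\<^sup>+\<eta>. (\<integral>\<^sup>+\<theta>. F (transpose \<eta> ** \<theta>) \<partial>mu) \<partial>mu)"
    by (rule nn_integral_cong_AE) (use AE_SO in \<open>auto elim!: eventually_mono simp: left_invariant SO_transpose\<close>)
  also have "\<dots> = (\<integral>\<^sup>+\<theta>. (\<integral>\<^sup>+\<eta>. F (transpose \<eta> ** \<theta>) \<partial>mu) \<partial>mu)"
    by (rule P.Fubini') measurable
  also have "\<dots> = (\<integral>\<^sup>+\<theta>. (\<integral>\<^sup>+\<eta>. F (transpose \<eta>) \<partial>mu) \<partial>mu)"
  proof (rule nn_integral_cong_AE, use AE_SO in eventually_elim)
    fix \<theta> :: "real^'n^'n" assume \<theta>: "\<theta> \<in> SO"
    have "(\<integral>\<^sup>+\<eta>. F (transpose \<eta> ** \<theta>) \<partial>mu) = (\<integral>\<^sup>+\<eta>. F (transpose (\<theta> ** \<eta>) ** \<theta>) \<partial>mu)"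
      by (rule left_invariant[OF \<theta>, symmetric]) measurable
    also have "\<dots> = (\<integral>\<^sup>+\<eta>. F (transpose \<eta>) \<partial>mu)"
      by (simp add: matrix_transpose_mul matrix_mul_assoc[symmetric] SO_transpose_mult[OF \<theta>])
    finally show "(\<integral>\<^sup>+\<eta>. F (transpose \<eta> ** \<theta>) \<partial>mu) = (\<integral>\<^sup>+\<eta>. F (transpose \<eta>) \<partial>mu)" .
  qed
  also have "\<dots> = (\<integral>\<^sup>+\<eta>. F (transpose \<eta>) \<partial>mu)" by (simp add: emeasure_space_1)
  finally show ?thesis by simp
qed

lemma right_invariant:
  assumes Q: "Q \<in> SO" and [measurable]: "F \<in> borel_measurable borel"
  shows "(\<integral>\<^sup>+\<theta>. F (\<theta> ** Q) \<partial>mu) = (\<integral>\<^sup>+\<theta>. F \<theta> \<partial>mu)"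
proof -
  have "(\<integral>\<^sup>+\<theta>. F (\<theta> ** Q) \<partial>mu) = (\<integral>\<^sup>+\<theta>. F (transpose \<theta> ** Q) \<partial>mu)"
    by (rule transpose_invariant[symmetric]) measurable
  also have "\<dots> = (\<integral>\<^sup>+\<theta>. F (transpose (transpose Q ** \<theta>)) \<partial>mu)"
    by (simp add: matrix_transpose_mul)
  also have "\<dots> = (\<integral>\<^sup>+\<theta>. F (transpose \<theta>) \<partial>mu)"
    by (rule left_invariant[OF SO_transpose[OF Q]]) measurable
  also have "\<dots> = (\<integral>\<^sup>+\<theta>. F \<theta> \<partial>mu)" by (rule transpose_invariant) measurable
  finally show ?thesis .
qed

end

subsection \<open>General position of random subspaces\<close>

text \<open>Bounding both summands and the matrix by \<open>n\<close> exhibits the set as a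
  countable union of continuous images of compact sets.\<close>

lemma sets_sum_rot:
  fixes L M :: "(real^'n) set"
  assumes L: "subspace L" and M: "subspace M"
  shows "{p. fst p \<in> minkowski_sum L (rot (snd p) M)} \<in> sets (borel \<Otimes>\<^sub>M borel)"
proof -
  define K where "K n = (\<lambda>(l, m, \<theta>). (l + \<theta> *v m, \<theta>)) ` ((L \<inter> cball 0 (real n)) \<times> (M \<inter> cball 0 (real n)) \<times>
    (cball 0 (real n) :: (real^'n^'n) set))" for n
  have "compact (K n)" for n
    unfolding K_def
  proof (rule compact_continuous_image)
    show "continuous_on ((L \<inter> cball 0 (real n)) \<times> (M \<inter> cball 0 (real n)) \<times> cball 0 (real n))
       (\<lambda>(l, m, \<theta> :: real^'n^'n). (l + \<theta> *v m, \<theta>))"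
      unfolding case_prod_beta matrix_vector_mult_def by (intro continuous_intros)
    show "compact ((L \<inter> cball 0 (real n)) \<times> (M \<inter> cball 0 (real n)) \<times> (cball 0 (real n) :: (real^'n^'n) set))"
      by (intro compact_Times closed_Int_compact closed_subspace L M compact_cball)
  qed
  then have "K n \<in> sets (borel \<Otimes>\<^sub>M borel)" for n
    unfolding borel_prod by (rule borel_closed[OF compact_imp_closed])
  then have "(\<Union>n. K n) \<in> sets (borel \<Otimes>\<^sub>M borel)" by blast
  also have "(\<Union>n. K n) = {p. fst p \<in> minkowski_sum L (rot (snd p) M)}"
  proof safe
    fix x \<theta> n assume "(x, \<theta>) \<in> K n"
    then show "fst (x, \<theta>) \<in> minkowski_sum L (rot (snd (x, \<theta>)) M)"
      by (auto simp: K_def minkowski_sum_def rot_def)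
  next
    fix x and \<theta> :: "real^'n^'n" assume "fst (x, \<theta>) \<in> minkowski_sum L (rot (snd (x, \<theta>)) M)"
    then obtain l m where lm: "x = l + \<theta> *v m" "l \<in> L" "m \<in> M"
      by (auto simp: minkowski_sum_def rot_def)
    obtain n where "max (norm l) (max (norm m) (norm \<theta>)) \<le> real n"
      using real_arch_simple by blast
    then have "(x, \<theta>) \<in> K n"
      unfolding K_def using lm by (intro image_eqI[of _ _ "(l, m, \<theta>)"]) auto
    then show "(x, \<theta>) \<in> (\<Union>n. K n)" by blast
  qed
  finally show ?thesis .
qed

lemma dim_rot_le: "dim (rot Q M) \<le> dim M"
  unfolding rot_def by (rule dim_image_le) simp

lemma dim_minkowski_sum_le:
  assumes "subspace L" "subspace M"
  shows "dim (minkowski_sum L M) \<le> dim L + dim M"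
  using dim_sums_Int[OF assms] by (simp add: minkowski_sum_def)

context haar_rotation
begin

text \<open>The probability of \<open>b \<in> L + \<theta> M\<close> is the same for all \<open>b \<notin> L\<close>; integrating it
  over \<open>b\<close> gives zero since \<open>L + \<theta> M\<close> is a proper subspace.\<close>

lemma AE_not_in_sum_rot:
  fixes L M :: "(real^'n) set"
  assumes L: "subspace L" and M: "subspace M" and b: "b \<notin> L"
    and dims: "dim L + dim M + 1 < CARD('n)" "dim M \<ge> 1"
  shows "AE \<theta> in mu. b \<notin> minkowski_sum L (rot \<theta> M)"
proof -
  note sets_sum_rot[OF L M, measurable]
  define I :: "real^'n \<Rightarrow> real^'n^'n \<Rightarrow> ennreal"
    where "I x \<theta> = indicator {p. fst p \<in> minkowski_sum L (rot (snd p) M)} (x, \<theta>)" for x \<theta>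
  have [measurable]: "(\<lambda>p. I (fst p) (snd p)) \<in> borel_measurable (borel \<Otimes>\<^sub>M borel)"
    unfolding I_def by simp
  have I2[measurable]: "(\<lambda>\<theta>. I x \<theta>) \<in> borel_measurable borel" for x
    using measurable_compose[OF measurable_Pair[OF measurable_const[of x borel borel] measurable_ident]
        \<open>(\<lambda>p. I (fst p) (snd p)) \<in> borel_measurable (borel \<Otimes>\<^sub>M borel)\<close>] by simp
  have I: "I x \<theta> = I y \<eta>" if "x \<in> minkowski_sum L (rot \<theta> M) \<longleftrightarrow> y \<in> minkowski_sum L (rot \<eta> M)" for x y \<theta> \<eta>
    using that by (simp add: I_def indicator_def)
  define q where "q x = (\<integral>\<^sup>+\<theta>. I x \<theta> \<partial>mu)" for x
  have sub: "subspace (minkowski_sum L (rot \<theta> M))" for \<theta>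
    by (intro minkowski_sum_subspace L subspace_rot M)
  have Lsub: "l \<in> minkowski_sum L (rot \<theta> M)" if "l \<in> L" for l \<theta>
    unfolding minkowski_sum_def using that subspace_0[OF subspace_rot[OF M, of \<theta>]] by force
  have q_rot: "q (Q *v x) = q x" if Q: "Q \<in> SO" and fix': "\<And>l. l \<in> L \<Longrightarrow> Q *v l = l" for Q x
  proof -
    have "(\<integral>\<^sup>+\<theta>. I (Q *v x) \<theta> \<partial>mu) = (\<integral>\<^sup>+\<theta>. I (Q *v x) (Q ** \<theta>) \<partial>mu)"
      by (rule left_invariant[OF Q, symmetric]) measurable
    also have "\<dots> = (\<integral>\<^sup>+\<theta>. I x \<theta> \<partial>mu)"
    proof (rule nn_integral_cong, rule I)
      fix \<theta>
      have inj: "inj ((*v) Q)" using orthogonal_transformation_inj[OF SO_orthogonal_transformation[OF Q]] .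
      have "minkowski_sum L (rot (Q ** \<theta>) M) = (*v) Q ` minkowski_sum L (rot \<theta> M)"
      proof safe
        fix z assume "z \<in> minkowski_sum L (rot (Q ** \<theta>) M)"
        then obtain l m where "z = l + Q *v (\<theta> *v m)" "l \<in> L" "m \<in> M"
          by (auto simp: minkowski_sum_def rot_def matrix_vector_mul_assoc)
        then have "z = Q *v (l + \<theta> *v m)" by (simp add: matrix_vector_right_distrib fix')
        then show "z \<in> (*v) Q ` minkowski_sum L (rot \<theta> M)"
          using \<open>l \<in> L\<close> \<open>m \<in> M\<close> by (auto simp: minkowski_sum_def rot_def)
      next
        fix z assume "z \<in> minkowski_sum L (rot \<theta> M)"
        then obtain l m where "z = l + \<theta> *v m" "l \<in> L" "m \<in> M"
          by (auto simp: minkowski_sum_def rot_def)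
        then show "Q *v z \<in> minkowski_sum L (rot (Q ** \<theta>) M)"
          by (auto simp: minkowski_sum_def rot_def matrix_vector_right_distrib fix' matrix_vector_mul_assoc)
      qed
      then show "Q *v x \<in> minkowski_sum L (rot (Q ** \<theta>) M) \<longleftrightarrow> x \<in> minkowski_sum L (rot \<theta> M)"
        using inj by (simp add: inj_image_mem_iff)
    qed
    finally show ?thesis unfolding q_def .
  qed
  have q_scale: "q (r *\<^sub>R x) = q x" if "r \<noteq> 0" for r x
    unfolding q_def
  proof (rule nn_integral_cong, rule I)
    fix \<theta> show "r *\<^sub>R x \<in> minkowski_sum L (rot \<theta> M) \<longleftrightarrow> x \<in> minkowski_sum L (rot \<theta> M)"
      using subspace_scale[OF sub, of x \<theta> r] subspace_scale[OF sub, of "r *\<^sub>R x" \<theta> "1/r"] that by auto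
  qed
  \<comment> \<open>\<open>L\<close> is contained in every one of the random subspaces, so only the
    component orthogonal to \<open>L\<close> decides membership.\<close>
  have q_proj: "q (x - proj L x) = q x" for x
    unfolding q_def
  proof (rule nn_integral_cong, rule I)
    fix \<theta> show "x - proj L x \<in> minkowski_sum L (rot \<theta> M) \<longleftrightarrow> x \<in> minkowski_sum L (rot \<theta> M)"
      using subspace_add[OF sub, of "x - proj L x" \<theta> "proj L x"] subspace_diff[OF sub, of x \<theta> "proj L x"]
        Lsub[OF proj_in[OF L]] by auto
  qed
  have q_const: "q x = q b" if x: "x \<notin> L" for x
  proof -
    let ?x = "x - proj L x" and ?b = "b - proj L b"
    have x0: "?x \<noteq> 0" and b0: "?b \<noteq> 0" using x b proj_in[OF L] by (metis eq_iff_diff_eq_0)+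
    define r where "r = norm ?b / norm ?x"
    have r: "r \<noteq> 0" using x0 b0 by (simp add: r_def)
    have rn: "norm (r *\<^sub>R ?x) = norm ?b" using x0 by (simp add: r_def)
    \<comment> \<open>Room for a direction orthogonal to \<open>L\<close> and to both components:
      since \<open>dim M\<close> is at least 1, the dimension hypothesis yields dim L + 2 <
      d.\<close>
    have "dim (insert ?b (insert ?x L)) \<le> dim L + 2"
      using dim_insert[of ?b "insert ?x L"] dim_insert[of ?x L] by (auto split: if_splits)
    also have "\<dots> < DIM(real^'n)" using dims by simp
    finally obtain w where w: "w \<noteq> 0" "\<And>y. y \<in> span (insert ?b (insert ?x L)) \<Longrightarrow> orthogonal w y"
      by (rule orthogonal_to_subspace_exists) blast
    have wo: "y \<bullet> w = 0" if "y \<in> insert ?b (insert ?x L)" for y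
      using w(2)[OF span_base[OF that]] by (simp add: orthogonal_def inner_commute)
    obtain Q where Q: "Q \<in> SO" "Q *v (r *\<^sub>R ?x) = ?b"
      "\<And>z. z \<bullet> w = 0 \<Longrightarrow> z \<bullet> (r *\<^sub>R ?x - ?b) = 0 \<Longrightarrow> Q *v z = z"
      using wo by (auto intro: SO_transitive[OF rn w(1)])
    have "Q *v l = l" if "l \<in> L" for l
    proof (rule Q(3))
      show "l \<bullet> w = 0" using wo that by simp
      have "l \<bullet> ?x = 0" "l \<bullet> ?b = 0"
        using proj_orth[OF L that] by (simp_all add: inner_commute[of l])
      then show "l \<bullet> (r *\<^sub>R ?x - ?b) = 0" by (simp only: inner_diff_right[of l "r *\<^sub>R ?x"] inner_scaleR_right)
    qed
    from q_rot[OF Q(1) this, of "r *\<^sub>R ?x"] show ?thesis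
      unfolding Q(2) by (simp only: q_scale[OF r] q_proj)
  qed
  interpret P: pair_sigma_finite "std_gaussian :: (real^'n) measure" mu ..
  have "(\<integral>\<^sup>+x. q x \<partial>std_gaussian) = (\<integral>\<^sup>+\<theta>. (\<integral>\<^sup>+x. I x \<theta> \<partial>std_gaussian) \<partial>mu)"
    unfolding q_def by (rule P.Fubini'[symmetric]) (simp add: case_prod_beta cong: measurable_cong_sets)
  also have "\<dots> = (\<integral>\<^sup>+\<theta>. 0 \<partial>mu)"
  proof (rule nn_integral_cong)
    fix \<theta>
    have "dim (minkowski_sum L (rot \<theta> M)) < DIM(real^'n)"
      using dim_minkowski_sum_le[OF L subspace_rot[OF M, of \<theta>]] dim_rot_le[of \<theta> M] dims by simp
    from AE_std_gaussian[OF AE_lborel_not_in_subspace[OF sub this]]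
    have "AE x in std_gaussian. I x \<theta> = 0" by eventually_elim (simp add: I_def)
    then have "(\<integral>\<^sup>+x. I x \<theta> \<partial>std_gaussian) = (\<integral>\<^sup>+x. 0 \<partial>(std_gaussian :: (real^'n) measure))"
      by (rule nn_integral_cong_AE)
    then show "(\<integral>\<^sup>+x. I x \<theta> \<partial>std_gaussian) = 0" by simp
  qed
  finally have "(\<integral>\<^sup>+x. q x \<partial>std_gaussian) = 0" by simp
  moreover have "AE x in std_gaussian. q x = q b"
    using AE_std_gaussian[OF AE_lborel_not_in_subspace[OF L]] dims
    by (auto elim!: eventually_mono simp: q_const)
  then have "(\<integral>\<^sup>+x. q x \<partial>std_gaussian) = (\<integral>\<^sup>+x. q b \<partial>(std_gaussian :: (real^'n) measure))"
    by (rule nn_integral_cong_AE)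
  ultimately have "q b = 0" by simp
  then have "AE \<theta> in mu. I b \<theta> = 0"
    unfolding q_def by (subst (asm) nn_integral_0_iff_AE) auto
  then show ?thesis by eventually_elim (simp add: I_def indicator_def split: if_splits)
qed

text \<open>A basis of \<open>L\<close> is built up vector by vector. A common vector with nonzero
  coefficient at the new \<open>b\<close> could be solved for \<open>b\<close>, placing it in the
  sum of the old span and \<open>\<theta> M\<close>, which is a null event.\<close>

lemma AE_Int_rot_trivial:
  fixes L M :: "(real^'n) set"
  assumes L: "subspace L" and M: "subspace M" and dims: "dim L + dim M < CARD('n)"
  shows "AE \<theta> in mu. L \<inter> rot \<theta> M = {0}"
proof (cases "dim M = 0")
  case True
  then have "M = {0}" using subspace_0[OF M] by auto
  then have "L \<inter> rot \<theta> M = {0}" for \<theta> using subspace_0[OF L] by (auto simp: rot_def)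
  then show ?thesis by simp
next
  case False
  then have M1: "1 \<le> dim M" by linarith
  have "AE \<theta> in mu. span B \<inter> rot \<theta> M \<subseteq> {0}"
    if "finite B" "independent B" "card B + dim M < CARD('n)" for B
    using that
  proof (induction B rule: finite_induct)
    case empty
    then show ?case by simp
  next
    case (insert b B)
    have ind: "independent B" "b \<notin> span B" using insert.prems(1) insert.hyps by (auto simp: independent_insert)
    have d: "dim (span B) = card B" using ind(1) by (simp add: dim_eq_card_independent)
    have "AE \<theta> in mu. span B \<inter> rot \<theta> M \<subseteq> {0}" using insert ind by simp
    moreover have "AE \<theta> in mu. b \<notin> minkowski_sum (span B) (rot \<theta> M)"
      by (rule AE_not_in_sum_rot[OF subspace_span M ind(2)]) (use insert d M1 in \<open>simp_all\<close>)
    ultimately show ?case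
    proof eventually_elim
      fix \<theta> assume 1: "span B \<inter> rot \<theta> M \<subseteq> {0}" and 2: "b \<notin> minkowski_sum (span B) (rot \<theta> M)"
      show "span (insert b B) \<inter> rot \<theta> M \<subseteq> {0}"
      proof
        fix x assume x: "x \<in> span (insert b B) \<inter> rot \<theta> M"
        then obtain r where r: "x - r *\<^sub>R b \<in> span B" by (auto simp: span_insert)
        have "r = 0"
        proof (rule ccontr)
          assume "r \<noteq> 0"
          have "(-1/r) *\<^sub>R (x - r *\<^sub>R b) \<in> span B" using r by (rule span_scale)
          moreover have "(1/r) *\<^sub>R x \<in> rot \<theta> M" using x subspace_scale[OF subspace_rot[OF M]] by blast
          moreover have "b = (-1/r) *\<^sub>R (x - r *\<^sub>R b) + (1/r) *\<^sub>R x"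
            using \<open>r \<noteq> 0\<close> by (simp add: scaleR_diff_right)
          ultimately show False using 2 unfolding minkowski_sum_def by blast
        qed
        then show "x \<in> {0}" using 1 r x by auto
      qed
    qed
  qed
  note * = this
  obtain B where "B \<subseteq> L" "independent B" "L \<subseteq> span B" "card B = dim L"
    using basis_exists by blast
  moreover have "span B = L" using calculation L by (metis span_minimal subset_antisym)
  ultimately have "AE \<theta> in mu. L \<inter> rot \<theta> M \<subseteq> {0}"
    using *[of B] dims by (metis independent_imp_finite)
  then show ?thesis
    by eventually_elim (use subspace_0[OF L] subspace_0[OF subspace_rot[OF M]] in auto)
qed

end

subsection \<open>The generalized sine\<close>

text \<open>Each vector of \<open>vs\<close> multiplies the Gram determinant by its squared distance
  from the span of the preceding vectors, and this factor sees \<open>us\<close> only through its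
  span.\<close>

lemma gram_det_append_cong_left:
  fixes us us' vs :: "(real^'n) list"
  assumes "span (set us) = span (set us')" "gram_det us = gram_det us'"
  shows "gram_det (us @ vs) = gram_det (us' @ vs)"
proof (induction vs rule: rev_induct)
  case Nil
  then show ?case using assms by simp
next
  case (snoc v vs)
  have sp: "span (set (us @ vs)) = span (set (us' @ vs))"
    using assms(1) by (simp add: span_Un)
  let ?p = "proj (span (set (us @ vs))) v"
  have p: "?p \<in> span (set (us @ vs))" by (rule proj_in) simp
  have q: "(v - ?p) \<bullet> u = 0" if "u \<in> span (set (us @ vs))" for u
    by (rule proj_orth[OF _ that]) simp
  have "gram_det ((us @ vs) @ [?p + (v - ?p)]) = ((v - ?p) \<bullet> (v - ?p)) * gram_det (us @ vs)"
    by (rule gram_det_snoc[OF p]) (rule q, erule span_base)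
  moreover have "gram_det ((us' @ vs) @ [?p + (v - ?p)]) = ((v - ?p) \<bullet> (v - ?p)) * gram_det (us' @ vs)"
    by (rule gram_det_snoc, use p sp in simp, rule q, unfold sp, erule span_base)
  ultimately show ?case using snoc.IH by simp
qed

lemma gram_det_append_cong_right:
  fixes us vs vs' :: "(real^'n) list"
  assumes "span (set vs) = span (set vs')" "gram_det vs = gram_det vs'"
  shows "gram_det (us @ vs) = gram_det (us @ vs')"
proof (induction us)
  case Nil
  then show ?case using assms by simp
next
  case (Cons u us)
  have sp: "span (set (us @ vs)) = span (set (us @ vs'))"
    using assms(1) by (simp add: span_Un)
  let ?p = "proj (span (set (us @ vs))) u"
  have p: "?p \<in> span (set (us @ vs))" by (rule proj_in) simp
  have q: "(u - ?p) \<bullet> w = 0" if "w \<in> span (set (us @ vs))" for w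
    by (rule proj_orth[OF _ that]) simp
  have "gram_det ((?p + (u - ?p)) # (us @ vs)) = ((u - ?p) \<bullet> (u - ?p)) * gram_det (us @ vs)"
    by (rule gram_det_Cons[OF p]) (rule q, erule span_base)
  moreover have "gram_det ((?p + (u - ?p)) # (us @ vs')) = ((u - ?p) \<bullet> (u - ?p)) * gram_det (us @ vs')"
    by (rule gram_det_Cons, use p sp in simp, rule q, unfold sp, erule span_base)
  ultimately show ?case using Cons.IH by simp
qed

text \<open>Hadamard's inequality: every height is at most the norm of the vector it belongs
  to.\<close>

lemma gram_det_bounds:
  fixes vs :: "(real^'n) list"
  assumes "\<And>v. v \<in> set vs \<Longrightarrow> norm v \<le> 1"
  shows "0 \<le> gram_det vs \<and> gram_det vs \<le> 1"
  using assms
proof (induction vs)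
  case Nil
  then show ?case by simp
next
  case (Cons u us)
  let ?p = "proj (span (set us)) u"
  have p: "?p \<in> span (set us)" by (rule proj_in) simp
  have q: "(u - ?p) \<bullet> w = 0" if "w \<in> span (set us)" for w
    by (rule proj_orth[OF _ that]) simp
  have "gram_det ((?p + (u - ?p)) # us) = ((u - ?p) \<bullet> (u - ?p)) * gram_det us"
    by (rule gram_det_Cons[OF p]) (rule q, erule span_base)
  then have eq: "gram_det (u # us) = ((u - ?p) \<bullet> (u - ?p)) * gram_det us" by simp
  have "(norm u)\<^sup>2 \<le> 1" using Cons.prems[of u] by (simp add: abs_square_le_1)
  then have "(u - ?p) \<bullet> (u - ?p) \<le> 1"
    using norm_proj_Pythagoras[of "span (set us)" u] zero_le_power2[of "norm ?p"]
    unfolding power2_norm_eq_inner[symmetric] by (simp only: subspace_span simp_thms)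
  moreover have "0 \<le> gram_det us \<and> gram_det us \<le> 1" using Cons by simp
  ultimately show ?case unfolding eq by (simp add: mult_le_one)
qed

lemma gram_det_orthonormal:
  assumes "distinct bs" "\<forall>u\<in>set bs. norm u = 1" "pairwise orthogonal (set bs)"
  shows "gram_det bs = 1"
  using assms
proof (induction bs)
  case Nil
  then show ?case by simp
next
  case (Cons b bs)
  have "gram_det (b # bs) = (b \<bullet> b) * gram_det bs"
    by (rule gram_det_Cons_orthogonal) (use Cons.prems in \<open>auto simp: pairwise_insert orthogonal_def\<close>)
  moreover have "b \<bullet> b = 1" using Cons.prems by (simp add: norm_eq_1)
  ultimately show ?case using Cons by (simp add: pairwise_insert)
qed

lemma gram_det_map_orthogonal:
  assumes "orthogonal_transformation g"
  shows "gram_det (map g vs) = gram_det vs"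
proof -
  have "map g vs ! i \<bullet> map g vs ! p i = vs ! i \<bullet> vs ! p i"
    if "p permutes {..<length vs}" "i < length vs" for p i
    using permutes_in_image[OF that(1), of i] that(2) assms
    by (simp add: orthogonal_transformation_def)
  then show ?thesis
    unfolding gram_det_def length_map
    by (intro sum.cong refl arg_cong2[where f = "(*)"] prod.cong) auto
qed

lemma is_onb_exists:
  assumes "subspace L" shows "is_onb L (onb L)"
proof -
  obtain B where B: "B \<subseteq> L" "pairwise orthogonal B" "\<And>x. x \<in> B \<Longrightarrow> norm x = 1"
    "independent B" "span B = L"
    using orthonormal_basis_subspace[OF assms] by metis
  obtain bs where "set bs = B" "distinct bs"
    using finite_distinct_list[OF independent_imp_finite[OF B(4)]] by blast
  then have "is_onb L bs" using B by (auto simp: is_onb_def)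
  then show ?thesis unfolding onb_def by (rule someI)
qed

lemma is_onb_map:
  assumes g: "orthogonal_transformation g" and "is_onb L bs"
  shows "is_onb (g ` L) (map g bs)"
proof -
  have inj: "inj g" by (rule orthogonal_transformation_inj[OF g])
  have "span (g ` set bs) = g ` L"
    using assms linear_span_image[OF orthogonal_transformation_linear[OF g], of "set bs"]
    by (simp add: is_onb_def)
  moreover have "pairwise orthogonal (g ` set bs)"
    using assms by (auto simp: is_onb_def pairwise_def orthogonal_def orthogonal_transformation_def)
  ultimately show ?thesis
    using assms inj_on_subset[OF inj]
    by (auto simp: is_onb_def distinct_map orthogonal_transformation_norm[OF g])
qed

text \<open>Frees the sine from the choice hidden in \<open>onb\<close>. Orthonormal bases of one
  subspace share their span and have Gram determinant 1, so they may be exchanged on one side and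
  then on the other; nonnegativity disposes of the absolute value.\<close>

lemma gen_sine0_eq:
  fixes L M :: "(real^'n) set"
  assumes us: "is_onb L us" and vs: "is_onb M vs"
  shows "gen_sine0 L M = sqrt (gram_det (us @ vs))"
proof -
  have sL: "subspace L" and sM: "subspace M" using us vs by (metis is_onb_def subspace_span)+
  note oL = is_onb_exists[OF sL] and oM = is_onb_exists[OF sM]
  have gram1: "gram_det bs = 1" if "is_onb S bs" for S and bs :: "(real^'n) list"
    using that by (intro gram_det_orthonormal) (auto simp: is_onb_def)
  have "gram_det (onb L @ onb M) = gram_det (us @ onb M)"
    using oL us gram1[OF oL] gram1[OF us] by (intro gram_det_append_cong_left) (simp_all add: is_onb_def)
  also have "\<dots> = gram_det (us @ vs)"
    using oM vs gram1[OF oM] gram1[OF vs] by (intro gram_det_append_cong_right) (simp_all add: is_onb_def)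
  finally have eq: "gram_det (onb L @ onb M) = gram_det (us @ vs)" .
  have "0 \<le> gram_det (us @ vs)"
    by (intro gram_det_bounds[THEN conjunct1]) (use us vs in \<open>auto simp: is_onb_def\<close>)
  then show ?thesis by (simp add: gen_sine0_def parallelepiped_volume_def eq)
qed

lemma gen_sine0_bounds:
  assumes "subspace L" "subspace M"
  shows "gen_sine0 L M \<in> {0..1}"
proof -
  have "0 \<le> gram_det (onb L @ onb M) \<and> gram_det (onb L @ onb M) \<le> 1"
    using is_onb_exists[OF assms(1)] is_onb_exists[OF assms(2)]
    by (intro gram_det_bounds) (auto simp: is_onb_def)
  then show ?thesis
    using gen_sine0_eq[OF is_onb_exists[OF assms(1)] is_onb_exists[OF assms(2)]] by simp
qed

lemma gen_sine0_orthogonal: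
  assumes "subspace L" "subspace M" "orthogonal_transformation g"
  shows "gen_sine0 (g ` L) (g ` M) = gen_sine0 L M"
proof -
  note o = is_onb_exists[OF assms(1)] is_onb_exists[OF assms(2)]
  show ?thesis
    using gen_sine0_eq[OF is_onb_map[OF assms(3) o(1)] is_onb_map[OF assms(3) o(2)]]
      gen_sine0_eq[OF o] gram_det_map_orthogonal[OF assms(3), of "onb L @ onb M"] by simp
qed

text \<open>The basis chosen for \<open>rot \<theta> M\<close> need not vary measurably with
  \<open>\<theta>\<close>. Rotating one fixed basis of \<open>M\<close> instead gives the root of a
  polynomial in the entries of \<open>\<theta>\<close>, which agrees with the sine on
  \<open>SO\<close>.\<close>

lemma gen_sine0_rot_measurable:
  fixes L M :: "(real^'n) set"
  assumes "subspace L" "subspace M"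
  obtains h :: "real^'n^'n \<Rightarrow> real" where "h \<in> borel_measurable borel"
    "\<And>\<theta>. \<theta> \<in> SO \<Longrightarrow> gen_sine0 L (rot \<theta> M) = h \<theta>"
proof
  let ?us = "onb L" and ?vs = "onb M"
  let ?h = "\<lambda>\<theta>. sqrt (gram_det (?us @ map ((*v) \<theta>) ?vs))"
  have *: "(\<lambda>\<theta> :: real^'n^'n. (?us @ map ((*v) \<theta>) ?vs) ! i) \<in> borel_measurable borel"
    if "i < length (?us @ ?vs)" for i
  proof -
    have "(\<lambda>\<theta> :: real^'n^'n. (?us @ map ((*v) \<theta>) ?vs) ! i) =
      (\<lambda>\<theta>. if i < length ?us then ?us ! i else \<theta> *v (?vs ! (i - length ?us)))"
      using that by (auto simp: nth_append)
    then show ?thesis by simp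
  qed
  have "(\<lambda>\<theta> :: real^'n^'n. gram_det (?us @ map ((*v) \<theta>) ?vs)) \<in> borel_measurable borel"
    unfolding gram_det_def length_append length_map
    by (intro borel_measurable_sum borel_measurable_times borel_measurable_const
        borel_measurable_prod borel_measurable_inner *) (auto dest: permutes_in_image)
  then show "?h \<in> borel_measurable borel" by measurable
  show "gen_sine0 L (rot \<theta> M) = ?h \<theta>" if "\<theta> \<in> SO" for \<theta>
    unfolding rot_def
    by (rule gen_sine0_eq[OF is_onb_exists[OF assms(1)]
        is_onb_map[OF SO_orthogonal_transformation[OF that] is_onb_exists[OF assms(2)]]])
qed

lemma dim_rot:
  assumes "\<theta> \<in> SO" shows "dim (rot \<theta> M) = dim M"
  unfolding rot_def
  using orthogonal_transformation_inj[OF SO_orthogonal_transformation[OF assms]]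
  by (intro dim_image_eq) (auto intro: inj_on_subset)

lemma span_rot: "span (rot \<theta> D) = rot \<theta> (span D)"
  unfolding rot_def by (rule linear_span_image) simp

lemma cone_sine_rot:
  fixes C D :: "(real^'n) set"
  assumes "\<theta> \<in> SO" "dim C + dim D \<le> CARD('n)"
  shows "cone_sine C (rot \<theta> D) = gen_sine0 (span C) (rot \<theta> (span D))"
  using assms by (simp add: cone_sine_def gen_sine_def span_rot dim_rot)

subsection \<open>Averaging over rotations\<close>

lemma SO_image_subset_eq:
  assumes "Q \<in> SO" "subspace L" "(*v) Q ` L \<subseteq> L"
  shows "(*v) Q ` L = L"
proof (rule subspace_dim_equal)
  show "subspace ((*v) Q ` L)" using assms(2) by (rule linear_subspace_image[rotated]) simp
  show "dim L \<le> dim ((*v) Q ` L)" using dim_rot[OF assms(1), of L] by (simp add: rot_def)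
qed (use assms in auto)

text \<open>A vector \<open>w\<close> orthogonal to \<open>L\<close> exists because
  \<open>dim L\<close> is less than d. The rotation obtained from it moves points of
  \<open>L\<close> only in the direction x - y, which itself lies in \<open>L\<close>.\<close>

lemma SO_transitive_subspace:
  fixes L :: "(real^'n) set"
  assumes L: "subspace L" "dim L < CARD('n)" and xy: "x \<in> L" "y \<in> L" "norm x = norm y"
  obtains Q where "Q \<in> SO" "Q *v x = y" "(*v) Q ` L = L"
proof -
  obtain w where w: "w \<noteq> 0" "\<And>y. y \<in> span L \<Longrightarrow> orthogonal w y"
    by (rule orthogonal_to_subspace_exists[of L]) (use L(2) in auto)
  have wL: "z \<bullet> w = 0" if "z \<in> L" for z
    using w(2)[OF span_base[OF that]] by (simp add: orthogonal_def inner_commute)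
  obtain Q where Q: "Q \<in> SO" "Q *v x = y" "\<And>z. z \<bullet> w = 0 \<Longrightarrow> \<exists>c. Q *v z = z + c *\<^sub>R (x - y)"
    by (rule SO_transitive[OF xy(3) w(1) wL[OF xy(1)] wL[OF xy(2)]]) (rule that)
  have "Q *v z \<in> L" if "z \<in> L" for z
    using Q(3)[OF wL[OF that]] that L(1) xy by (auto intro!: subspace_add subspace_scale subspace_diff)
  then have "(*v) Q ` L = L" by (intro SO_image_subset_eq[OF Q(1) L(1)]) auto
  with Q show thesis by (intro that)
qed

lemma proj_SO:
  assumes "Q \<in> SO" "subspace L" "(*v) Q ` L = L"
  shows "proj L (Q *v x) = Q *v proj L x"
  using proj_orthogonal_image[OF assms(2) SO_orthogonal_transformation[OF assms(1)], of x] assms(3) by simp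

lemma SO_inner:
  assumes "Q \<in> SO" shows "(Q *v x) \<bullet> (Q *v y) = x \<bullet> y"
  using SO_orthogonal_transformation[OF assms] by (simp add: orthogonal_transformation_def)

lemma nn_integral_std_gaussian_SO:
  fixes F :: "real^'n \<Rightarrow> ennreal"
  assumes "Q \<in> SO" "F \<in> borel_measurable borel"
  shows "(\<integral>\<^sup>+x. F (Q *v x) \<partial>std_gaussian) = (\<integral>\<^sup>+x. F x \<partial>std_gaussian)"
  by (rule nn_integral_std_gaussian_orthogonal[OF SO_orthogonal_transformation[OF assms(1)] assms(2)])

text \<open>The integral W of the overview. \<open>UNIV\<close> in both places has the same effect
  as \<open>L\<close> and \<open>M\<close>, since projections land there. Values are extended
  because the full integral diverges when \<open>L\<close> and \<open>\<theta> M\<close> share a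
  line.\<close>

definition gauss_coupling :: "(real^'n) set \<Rightarrow> (real^'n) set \<Rightarrow> (real^'n) set \<Rightarrow> (real^'n) set \<Rightarrow> real^'n^'n \<Rightarrow> ennreal"
  where "gauss_coupling L M A B \<theta> = (\<integral>\<^sup>+x. \<integral>\<^sup>+y. indicator A (proj L x) * indicator B (proj M y) *
     ennreal (exp (- (proj L x \<bullet> (\<theta> *v proj M y)))) \<partial>std_gaussian \<partial>std_gaussian)"

lemma gauss_coupling_measurable [measurable]:
  fixes L M A B :: "(real^'n) set"
  assumes L: "subspace L" and M: "subspace M" and [measurable]: "A \<in> sets borel" "B \<in> sets borel"
  shows "gauss_coupling L M A B \<in> borel_measurable borel"
proof -
  have [measurable]: "proj L \<in> borel_measurable borel" "proj M \<in> borel_measurable borel"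
    using L M by simp_all
  show ?thesis unfolding gauss_coupling_def[abs_def] by measurable
qed

lemma gauss_coupling_left:
  fixes L M :: "(real^'n) set"
  assumes L: "subspace L" and M: "subspace M" and Q: "Q \<in> SO" "(*v) Q ` L = L"
  shows "gauss_coupling L M UNIV UNIV (Q ** \<theta>) = gauss_coupling L M UNIV UNIV \<theta>"
proof -
  have [measurable]: "proj L \<in> borel_measurable borel" "proj M \<in> borel_measurable borel"
    using L M by simp_all
  let ?H = "\<lambda>x. \<integral>\<^sup>+y. ennreal (exp (- (proj L x \<bullet> ((Q ** \<theta>) *v proj M y)))) \<partial>std_gaussian"
  have "(\<integral>\<^sup>+x. ?H x \<partial>std_gaussian) = (\<integral>\<^sup>+x. ?H (Q *v x) \<partial>std_gaussian)"
    by (rule nn_integral_std_gaussian_SO[OF Q(1), symmetric]) measurable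
  then show ?thesis
    unfolding gauss_coupling_def
    by (simp add: proj_SO[OF Q(1) L Q(2)] SO_inner[OF Q(1)] matrix_vector_mul_assoc[symmetric])
qed

lemma gauss_coupling_right:
  fixes L M :: "(real^'n) set"
  assumes L: "subspace L" and M: "subspace M" and Q: "Q \<in> SO" "(*v) Q ` M = M"
  shows "gauss_coupling L M UNIV UNIV (\<theta> ** Q) = gauss_coupling L M UNIV UNIV \<theta>"
proof -
  have [measurable]: "proj L \<in> borel_measurable borel" "proj M \<in> borel_measurable borel"
    using L M by simp_all
  have "(\<integral>\<^sup>+y. ennreal (exp (- (proj L x \<bullet> (\<theta> *v proj M y)))) \<partial>std_gaussian)
     = (\<integral>\<^sup>+y. ennreal (exp (- (proj L x \<bullet> (\<theta> *v proj M (Q *v y))))) \<partial>std_gaussian)" for x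
    by (rule nn_integral_std_gaussian_SO[OF Q(1), symmetric]) measurable
  then show ?thesis
    unfolding gauss_coupling_def
    by (simp add: proj_SO[OF Q(1) M Q(2)] matrix_vector_mul_assoc[symmetric])
qed

text \<open>\<open>D\<close> is taken closed so that its rotated copy is closed, and hence Borel, as
  well.\<close>

lemma emeasure_std_gaussian_sum_rot:
  fixes L M C D :: "(real^'n) set"
  assumes L: "subspace L" and M: "subspace M" and \<theta>: "\<theta> \<in> SO" and LM: "L \<inter> rot \<theta> M = {0}"
    and C: "C \<in> sets borel" "C \<subseteq> L" and D: "closed D" "D \<subseteq> M"
  shows "emeasure std_gaussian {z. proj (minkowski_sum L (rot \<theta> M)) z \<in> minkowski_sum C (rot \<theta> D)}
      = inverse (gauss_coupling L M UNIV UNIV \<theta>) * gauss_coupling L M C D \<theta>"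
    and "inverse (gauss_coupling L M UNIV UNIV \<theta>) * gauss_coupling L M UNIV UNIV \<theta> = 1"
proof -
  note o = SO_orthogonal_transformation[OF \<theta>]
  have rM: "subspace (rot \<theta> M)" by (rule subspace_rot[OF M])
  have pb: "proj (rot \<theta> M) (\<theta> *v y) = \<theta> *v proj M y" for y
    using proj_orthogonal_image[OF M o] by (simp add: rot_def)
  have inj: "inj ((*v) \<theta>)" by (rule orthogonal_transformation_inj[OF o])
  have [measurable]: "proj L \<in> borel_measurable borel" "proj (rot \<theta> M) \<in> borel_measurable borel"
    using L rM by simp_all
  \<comment> \<open>Substituting \<open>\<theta> *v y\<close> for \<open>y\<close> moves the
    rotation out of the projection and the set and into the kernel.\<close>
  have coup: "(\<integral>\<^sup>+x. \<integral>\<^sup>+y. indicator A (proj L x) * indicator (rot \<theta> B) (proj (rot \<theta> M) y) *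
         ennreal (exp (- (proj L x \<bullet> proj (rot \<theta> M) y))) \<partial>std_gaussian \<partial>std_gaussian)
    = gauss_coupling L M A B \<theta>" if [measurable]: "A \<in> sets borel" "rot \<theta> B \<in> sets borel" for A B
  proof -
    have i: "indicator (rot \<theta> B) (\<theta> *v y) = (indicator B y :: ennreal)" for y
      using inj by (simp add: indicator_def rot_def inj_image_mem_iff)
    have "(\<integral>\<^sup>+y. indicator A (proj L x) * indicator (rot \<theta> B) (proj (rot \<theta> M) y) *
         ennreal (exp (- (proj L x \<bullet> proj (rot \<theta> M) y))) \<partial>std_gaussian)
      = (\<integral>\<^sup>+y. indicator A (proj L x) * indicator (rot \<theta> B) (proj (rot \<theta> M) (\<theta> *v y)) *
         ennreal (exp (- (proj L x \<bullet> proj (rot \<theta> M) (\<theta> *v y)))) \<partial>std_gaussian)" for x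
      by (rule nn_integral_std_gaussian_SO[OF \<theta>, symmetric]) measurable
    then show ?thesis unfolding gauss_coupling_def by (simp add: pb i)
  qed
  have rD: "rot \<theta> D \<in> sets borel"
  proof (rule borel_closed)
    show "closed (rot \<theta> D)"
      unfolding rot_def using D(1) inj by (intro closed_injective_linear_image) simp_all
  qed
  obtain s where s: "s > 0" "\<And>A B. A \<in> sets borel \<Longrightarrow> B \<in> sets borel \<Longrightarrow> A \<subseteq> L \<Longrightarrow> B \<subseteq> rot \<theta> M \<Longrightarrow>
      emeasure std_gaussian {z. proj (minkowski_sum L (rot \<theta> M)) z \<in> minkowski_sum A B} =
      ennreal s * (\<integral>\<^sup>+x. \<integral>\<^sup>+y. indicator A (proj L x) * indicator B (proj (rot \<theta> M) y) *
         ennreal (exp (- (proj L x \<bullet> proj (rot \<theta> M) y))) \<partial>std_gaussian \<partial>std_gaussian)"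
    by (rule emeasure_std_gaussian_minkowski_sum[OF L rM LM]) (rule that)
  have Lb: "L \<in> sets borel" "rot \<theta> M \<in> sets borel"
    using L rM by (simp_all add: borel_closed closed_subspace)
  have "gauss_coupling L M L M \<theta> = gauss_coupling L M UNIV UNIV \<theta>"
    unfolding gauss_coupling_def by (simp add: proj_in[OF L] proj_in[OF M])
  moreover have "{z. proj (minkowski_sum L (rot \<theta> M)) z \<in> minkowski_sum L (rot \<theta> M)} = UNIV"
    using proj_in[OF minkowski_sum_subspace[OF L rM]] by simp
  ultimately have Z: "ennreal s * gauss_coupling L M UNIV UNIV \<theta> = 1"
    using s(2)[OF Lb subset_refl subset_refl] by (simp only: coup[OF Lb]) simp
  \<comment> \<open>The product with the positive real \<open>s\<close> being 1 excludes an infinite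
    coupling, and makes the extended inverse a genuine one.\<close>
  have inv: "inverse (gauss_coupling L M UNIV UNIV \<theta>) = ennreal s"
  proof (cases "gauss_coupling L M UNIV UNIV \<theta>")
    case (real z)
    then have sz: "s * z = 1" using Z s(1) by (simp add: ennreal_mult[symmetric])
    then have "z = 1 / s" using s(1) by (simp add: field_simps)
    then show ?thesis using real s(1) by (simp add: inverse_ennreal)
  next
    case top
    then show ?thesis using Z s(1) by (simp add: ennreal_mult_top)
  qed
  show "inverse (gauss_coupling L M UNIV UNIV \<theta>) * gauss_coupling L M UNIV UNIV \<theta> = 1"
    unfolding inv by (rule Z)
  have "rot \<theta> D \<subseteq> rot \<theta> M" using D(2) by (auto simp: rot_def)
  from s(2)[OF C(1) rD C(2) this]
  show "emeasure std_gaussian {z. proj (minkowski_sum L (rot \<theta> M)) z \<in> minkowski_sum C (rot \<theta> D)}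
      = inverse (gauss_coupling L M UNIV UNIV \<theta>) * gauss_coupling L M C D \<theta>"
    unfolding coup[OF C(1) rD] inv .
qed

lemma nn_integral_std_gaussian_cone:
  fixes L C :: "(real^'n) set" and \<Psi> :: "real^'n \<Rightarrow> ennreal"
  assumes L: "subspace L" and C: "C \<in> sets borel" and cone: "\<And>r x. r > 0 \<Longrightarrow> x \<in> C \<Longrightarrow> r *\<^sub>R x \<in> C"
    and [measurable]: "\<Psi> \<in> borel_measurable borel"
    and radial: "\<And>x y. x \<in> L \<Longrightarrow> y \<in> L \<Longrightarrow> norm x = norm y \<Longrightarrow> \<Psi> x = \<Psi> y"
  shows "(\<integral>\<^sup>+x. indicator C (proj L x) * \<Psi> (proj L x) \<partial>std_gaussian)
    = emeasure std_gaussian {x. proj L x \<in> C} * (\<integral>\<^sup>+x. \<Psi> (proj L x) \<partial>std_gaussian)"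
proof -
  \<comment> \<open>A ray on which every length occurring in \<open>L\<close> is attained: a unit
    vector spans it, or 0 when \<open>L\<close> is trivial. Restricted to this ray,
    \<open>\<Psi>\<close> becomes a function of the length.\<close>
  obtain u where u: "u \<in> L" "\<And>x. x \<in> L \<Longrightarrow> norm (norm x *\<^sub>R u) = norm x"
  proof (cases "L \<subseteq> {0}")
    case True
    then show thesis using that[of 0] subspace_0[OF L] by auto
  next
    case False
    then obtain v where v: "v \<in> L" "v \<noteq> 0" by auto
    show thesis
      by (rule that[of "(1 / norm v) *\<^sub>R v"]) (use v L in \<open>simp_all add: subspace_scale\<close>)
  qed
  have eq: "\<Psi> (proj L x) = \<Psi> (norm (proj L x) *\<^sub>R u)" for x
    by (rule radial) (use proj_in[OF L] u in \<open>simp_all add: subspace_scale[OF L]\<close>)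
  have "(\<lambda>r. \<Psi> (r *\<^sub>R u)) \<in> borel_measurable borel" by measurable
  from nn_integral_std_gaussian_radial[OF L C cone this] show ?thesis by (simp flip: eq)
qed

context haar_rotation
begin

text \<open>The Fubini identity \<open>fub\<close> is used twice: for the cones, which then split
  off, and for \<open>UNIV\<close>, which evaluates the radial integral left over, because there
  \<open>k\<close> times the coupling is \<open>h\<close> again almost everywhere.\<close>

lemma nn_integral_gauss_coupling:
  fixes L M C D :: "(real^'n) set" and h :: "real^'n^'n \<Rightarrow> ennreal"
  assumes L: "subspace L" and M: "subspace M" and dims: "dim L + dim M < CARD('n)"
    and C: "C \<in> sets borel" "\<And>r x. r > 0 \<Longrightarrow> x \<in> C \<Longrightarrow> r *\<^sub>R x \<in> C"
    and D: "D \<in> sets borel" "\<And>r x. r > 0 \<Longrightarrow> x \<in> D \<Longrightarrow> r *\<^sub>R x \<in> D"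
    and h [measurable]: "h \<in> borel_measurable borel"
    and hL: "\<And>Q \<theta>. Q \<in> SO \<Longrightarrow> \<theta> \<in> SO \<Longrightarrow> (*v) Q ` L = L \<Longrightarrow> h (Q ** \<theta>) = h \<theta>"
    and hM: "\<And>Q \<theta>. Q \<in> SO \<Longrightarrow> \<theta> \<in> SO \<Longrightarrow> (*v) Q ` M = M \<Longrightarrow> h (\<theta> ** Q) = h \<theta>"
  shows "(\<integral>\<^sup>+\<theta>. h \<theta> * (inverse (gauss_coupling L M UNIV UNIV \<theta>) * gauss_coupling L M C D \<theta>) \<partial>mu)
    = emeasure std_gaussian {x. proj L x \<in> C} * emeasure std_gaussian {x. proj M x \<in> D} * (\<integral>\<^sup>+\<theta>. h \<theta> \<partial>mu)"
proof -
  interpret P: pair_sigma_finite "std_gaussian :: (real^'n) measure" mu ..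
  have [measurable]: "proj L \<in> borel_measurable borel" "proj M \<in> borel_measurable borel"
    using L M by simp_all
  define k where "k \<theta> = h \<theta> * inverse (gauss_coupling L M UNIV UNIV \<theta>)" for \<theta>
  have [measurable]: "gauss_coupling L M UNIV UNIV \<in> borel_measurable borel"
    by (rule gauss_coupling_measurable[OF L M]) simp_all
  have [measurable]: "k \<in> borel_measurable borel" unfolding k_def[abs_def] by measurable
  have kL: "k (Q ** \<theta>) = k \<theta>" if "Q \<in> SO" "\<theta> \<in> SO" "(*v) Q ` L = L" for Q \<theta>
    using that by (simp add: k_def hL gauss_coupling_left[OF L M])
  have kM: "k (\<theta> ** Q) = k \<theta>" if "Q \<in> SO" "\<theta> \<in> SO" "(*v) Q ` M = M" for Q \<theta>
    using that by (simp add: k_def hM gauss_coupling_right[OF L M])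
  define \<Phi> where "\<Phi> x y = (\<integral>\<^sup>+\<theta>. k \<theta> * ennreal (exp (- (x \<bullet> (\<theta> *v y)))) \<partial>mu)" for x y
  have \<Phi>_meas [measurable]: "(\<lambda>p. \<Phi> (fst p) (snd p)) \<in> borel_measurable (borel \<Otimes>\<^sub>M borel)"
    unfolding \<Phi>_def[abs_def] by measurable
  have \<Phi>_meas' [measurable]: "(\<lambda>x. \<Phi> x y) \<in> borel_measurable borel" "(\<lambda>y. \<Phi> x y) \<in> borel_measurable borel" for x y
    unfolding \<Phi>_def[abs_def] by measurable
  have \<Phi>_int [measurable]: "(\<lambda>x. \<integral>\<^sup>+y. \<Phi> x (proj M y) \<partial>std_gaussian) \<in> borel_measurable borel"
  proof (rule std_gaussian.borel_measurable_nn_integral)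
    have "(\<lambda>p. (fst p, proj M (snd p))) \<in> borel \<Otimes>\<^sub>M std_gaussian \<rightarrow>\<^sub>M borel \<Otimes>\<^sub>M borel" by measurable
    from measurable_compose[OF this \<Phi>_meas]
    show "(\<lambda>(x, y). \<Phi> x (proj M y)) \<in> borel_measurable (borel \<Otimes>\<^sub>M std_gaussian)"
      by (simp add: case_prod_beta)
  qed
  \<comment> \<open>Replacing \<open>\<theta>\<close> by \<open>Q ** \<theta>\<close> leaves
    \<open>k\<close> alone since \<open>Q\<close> preserves \<open>L\<close>, and in the kernel
    \<open>Q\<close> cancels against x' = Q x. For the second argument the rotation acts from the
    right.\<close>
  have rad1: "\<Phi> x y = \<Phi> x' y" if "x \<in> L" "x' \<in> L" "norm x = norm x'" for x x' y
  proof -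
    have "dim L < CARD('n)" using dims by simp
    note tr = SO_transitive_subspace[OF L this that]
    obtain Q where Q: "Q \<in> SO" "Q *v x = x'" "(*v) Q ` L = L" by (rule tr) (rule that)
    have "\<Phi> x' y = (\<integral>\<^sup>+\<theta>. k (Q ** \<theta>) * ennreal (exp (- (x' \<bullet> ((Q ** \<theta>) *v y)))) \<partial>mu)"
      unfolding \<Phi>_def by (rule left_invariant[OF Q(1), symmetric]) measurable
    also have "\<dots> = \<Phi> x y"
      unfolding \<Phi>_def Q(2)[symmetric]
      by (rule nn_integral_cong_AE)
         (use AE_SO in \<open>auto elim!: eventually_mono simp: kL Q(1,3) SO_inner matrix_vector_mul_assoc[symmetric]\<close>)
    finally show ?thesis by simp
  qed
  have rad2: "\<Phi> x y = \<Phi> x y'" if "y \<in> M" "y' \<in> M" "norm y = norm y'" for x y y'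
  proof -
    have "dim M < CARD('n)" using dims by simp
    note tr = SO_transitive_subspace[OF M this that]
    obtain Q where Q: "Q \<in> SO" "Q *v y = y'" "(*v) Q ` M = M" by (rule tr) (rule that)
    have "\<Phi> x y = (\<integral>\<^sup>+\<theta>. k (\<theta> ** Q) * ennreal (exp (- (x \<bullet> ((\<theta> ** Q) *v y)))) \<partial>mu)"
      unfolding \<Phi>_def by (rule right_invariant[OF Q(1), symmetric]) measurable
    also have "\<dots> = \<Phi> x y'"
      unfolding \<Phi>_def Q(2)[symmetric]
      by (rule nn_integral_cong_AE)
         (use AE_SO in \<open>auto elim!: eventually_mono simp: kM Q(1,3) matrix_vector_mul_assoc[symmetric]\<close>)
    finally show ?thesis .
  qed
  have fub: "(\<integral>\<^sup>+\<theta>. k \<theta> * gauss_coupling L M A B \<theta> \<partial>mu) =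
    (\<integral>\<^sup>+x. indicator A (proj L x) * (\<integral>\<^sup>+y. indicator B (proj M y) * \<Phi> (proj L x) (proj M y) \<partial>std_gaussian) \<partial>std_gaussian)"
    if [measurable]: "A \<in> sets borel" "B \<in> sets borel" for A B
  proof -
    define W where "W x y \<theta> = indicator A (proj L x) * indicator B (proj M y) *
       ennreal (exp (- (proj L x \<bullet> (\<theta> *v proj M y))))" for x y \<theta>
    define e where "e x y \<theta> = k \<theta> * W x y \<theta>" for x y \<theta>
    have W1 [measurable]: "(\<lambda>y. W x y \<theta>) \<in> borel_measurable std_gaussian" for x \<theta>
      unfolding W_def by measurable
    have W2 [measurable]: "(\<lambda>x. \<integral>\<^sup>+y. W x y \<theta> \<partial>std_gaussian) \<in> borel_measurable std_gaussian" for \<theta>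
      unfolding W_def by measurable
    have e1: "(\<lambda>(x, \<theta>). \<integral>\<^sup>+y. e x y \<theta> \<partial>std_gaussian) \<in> borel_measurable (std_gaussian \<Otimes>\<^sub>M mu)"
      unfolding e_def W_def by measurable
    have e2: "(\<lambda>(y, \<theta>). e x y \<theta>) \<in> borel_measurable (std_gaussian \<Otimes>\<^sub>M mu)" for x
      unfolding e_def W_def by measurable
    have "(\<integral>\<^sup>+\<theta>. k \<theta> * gauss_coupling L M A B \<theta> \<partial>mu) =
       (\<integral>\<^sup>+\<theta>. \<integral>\<^sup>+x. \<integral>\<^sup>+y. e x y \<theta> \<partial>std_gaussian \<partial>std_gaussian \<partial>mu)"
    proof (rule nn_integral_cong)
      fix \<theta>
      show "k \<theta> * gauss_coupling L M A B \<theta> = (\<integral>\<^sup>+x. \<integral>\<^sup>+y. e x y \<theta> \<partial>std_gaussian \<partial>std_gaussian)"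
        unfolding e_def gauss_coupling_def W_def[symmetric]
        by (simp only: nn_integral_cmult[OF W1] nn_integral_cmult[OF W2])
    qed
    also have "\<dots> = (\<integral>\<^sup>+x. \<integral>\<^sup>+\<theta>. \<integral>\<^sup>+y. e x y \<theta> \<partial>std_gaussian \<partial>mu \<partial>std_gaussian)"
      by (rule P.Fubini'[OF e1])
    also have "\<dots> = (\<integral>\<^sup>+x. \<integral>\<^sup>+y. \<integral>\<^sup>+\<theta>. e x y \<theta> \<partial>mu \<partial>std_gaussian \<partial>std_gaussian)"
      by (rule nn_integral_cong) (rule P.Fubini'[OF e2])
    also have "\<dots> = (\<integral>\<^sup>+x. indicator A (proj L x) * (\<integral>\<^sup>+y. indicator B (proj M y) * \<Phi> (proj L x) (proj M y) \<partial>std_gaussian) \<partial>std_gaussian)"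
    proof (rule nn_integral_cong)
      fix x
      have "(\<integral>\<^sup>+\<theta>. e x y \<theta> \<partial>mu) = indicator A (proj L x) * (indicator B (proj M y) * \<Phi> (proj L x) (proj M y))" for y
      proof -
        have "(\<integral>\<^sup>+\<theta>. e x y \<theta> \<partial>mu) = (\<integral>\<^sup>+\<theta>. (indicator A (proj L x) * indicator B (proj M y)) *
          (k \<theta> * ennreal (exp (- (proj L x \<bullet> (\<theta> *v proj M y))))) \<partial>mu)"
          by (simp add: e_def W_def mult_ac)
        also have "\<dots> = (indicator A (proj L x) * indicator B (proj M y)) * \<Phi> (proj L x) (proj M y)"
          unfolding \<Phi>_def by (rule nn_integral_cmult) measurable
        finally show ?thesis by (simp add: mult.assoc)
      qed
      then show "(\<integral>\<^sup>+y. \<integral>\<^sup>+\<theta>. e x y \<theta> \<partial>mu \<partial>std_gaussian) =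
        indicator A (proj L x) * (\<integral>\<^sup>+y. indicator B (proj M y) * \<Phi> (proj L x) (proj M y) \<partial>std_gaussian)"
        by (simp add: nn_integral_cmult measurable_compose[OF _ \<Phi>_meas'(2)] M)
    qed
    finally show ?thesis .
  qed
  let ?c = "emeasure std_gaussian {x. proj L x \<in> C}" and ?d = "emeasure std_gaussian {x. proj M x \<in> D}"
  have "(\<integral>\<^sup>+\<theta>. k \<theta> * gauss_coupling L M C D \<theta> \<partial>mu) =
    (\<integral>\<^sup>+x. indicator C (proj L x) * (?d * (\<integral>\<^sup>+y. \<Phi> (proj L x) (proj M y) \<partial>std_gaussian)) \<partial>std_gaussian)"
    unfolding fub[OF C(1) D(1)]
    by (intro nn_integral_cong arg_cong2[where f = "(*)"] refl nn_integral_std_gaussian_cone[OF M D])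
       (auto intro: rad2)
  also have "\<dots> = ?c * (\<integral>\<^sup>+x. ?d * (\<integral>\<^sup>+y. \<Phi> (proj L x) (proj M y) \<partial>std_gaussian) \<partial>std_gaussian)"
    by (rule nn_integral_std_gaussian_cone[OF L C, where \<Psi> = "\<lambda>x. ?d * (\<integral>\<^sup>+y. \<Phi> x (proj M y) \<partial>std_gaussian)"])
       (measurable, rule arg_cong2[where f = "(*)", OF refl nn_integral_cong], rule rad1)
  also have "\<dots> = ?c * ?d * (\<integral>\<^sup>+x. (\<integral>\<^sup>+y. \<Phi> (proj L x) (proj M y) \<partial>std_gaussian) \<partial>std_gaussian)"
    by (subst nn_integral_cmult) (rule measurable_compose[OF _ \<Phi>_int], simp_all add: L mult.assoc)
  also have "(\<integral>\<^sup>+x. (\<integral>\<^sup>+y. \<Phi> (proj L x) (proj M y) \<partial>std_gaussian) \<partial>std_gaussian) =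
      (\<integral>\<^sup>+\<theta>. k \<theta> * gauss_coupling L M UNIV UNIV \<theta> \<partial>mu)"
    using fub[of UNIV UNIV] by simp
  also have "\<dots> = (\<integral>\<^sup>+\<theta>. h \<theta> \<partial>mu)"
  proof (rule nn_integral_cong_AE, use AE_SO AE_Int_rot_trivial[OF L M dims] in eventually_elim)
    fix \<theta> assume "\<theta> \<in> SO" "L \<inter> rot \<theta> M = {0}"
    from emeasure_std_gaussian_sum_rot(2)[OF L M this, of "{}" "{}"]
    show "k \<theta> * gauss_coupling L M UNIV UNIV \<theta> = h \<theta>"
      by (simp add: k_def mult.assoc)
  qed
  finally show ?thesis by (simp add: k_def mult.assoc)
qed

end

subsection \<open>The rotation sum formula\<close>

lemma polyhedral_cone_closed: "polyhedral_cone C \<Longrightarrow> closed C"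
proof -
  assume "polyhedral_cone C"
  then obtain S where "C = (\<Inter>a\<in>S. {x. a \<bullet> x \<le> 0})" by (auto simp: polyhedral_cone_def)
  then show "closed C" by (simp add: closed_INT closed_halfspace_le)
qed

lemma polyhedral_cone_zero: "polyhedral_cone C \<Longrightarrow> 0 \<in> C"
  by (auto simp: polyhedral_cone_def)

lemma polyhedral_cone_scale: "polyhedral_cone C \<Longrightarrow> r > 0 \<Longrightarrow> x \<in> C \<Longrightarrow> r *\<^sub>R x \<in> C"
  by (auto simp: polyhedral_cone_def mult_nonneg_nonpos)

lemma polyhedral_cone_convex: "polyhedral_cone C \<Longrightarrow> convex C"
proof -
  assume "polyhedral_cone C"
  then obtain S where "C = (\<Inter>a\<in>S. {x. a \<bullet> x \<le> 0})" by (auto simp: polyhedral_cone_def)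
  then show "convex C" by (simp add: convex_INT convex_halfspace_le)
qed

text \<open>Proper faces have smaller dimension, so \<open>X\<close> is the only candidate for an
  m-face, and its normal cone at itself is the orthogonal complement of its span. Allowing
  \<open>dim X\<close> below \<open>m\<close> covers rotations for which the sum of the cones
  degenerates.\<close>

lemma conic_intrinsic_volume_top:
  fixes X :: "(real^'n) set"
  assumes X: "convex X" "0 \<in> X" and m: "dim X \<le> m"
  shows "conic_intrinsic_volume m X =
    (if dim X = m then measure std_gaussian {x. proj (span X) x \<in> X} else 0)"
proof -
  have aff: "aff_dim X = int (dim X)" using X(2) by (simp add: aff_dim_zero hull_inc)
  have faces: "k_faces m X = (if dim X = m then {X} else {})"
  proof -
    have "F = X \<and> dim X = m" if "F face_of X" "aff_dim F = int m" for F
    proof -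
      have "F = X"
      proof (rule ccontr)
        assume "F \<noteq> X"
        then have "aff_dim F < aff_dim X" using face_of_aff_dim_lt[OF X(1) that(1)] by simp
        then show False using that(2) aff m by simp
      qed
      then show ?thesis using that(2) aff by simp
    qed
    then show ?thesis using aff face_of_refl[OF X(1)] by (auto simp: k_faces_def)
  qed
  have "minkowski_sum X (normal_cone X X) = {x. proj (span X) x \<in> X}"
  proof safe
    fix x assume "x \<in> minkowski_sum X (normal_cone X X)"
    then obtain u y where x: "x = u + y" "u \<in> X" "\<And>z. z \<in> X \<Longrightarrow> orthogonal y z"
      by (auto simp: minkowski_sum_def normal_cone_def orthogonal_def)
    have "orthogonal y z" if "z \<in> span X" for z
      using orthogonal_to_span[OF that] x(3) by blast
    then have "proj (span X) x = u"
      using x by (intro proj_unique) (auto simp: span_base orthogonal_def)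
    then show "proj (span X) x \<in> X" using x by simp
  next
    fix x assume p: "proj (span X) x \<in> X"
    have "(x - proj (span X) x) \<bullet> z = 0" if "z \<in> X" for z
      by (rule proj_orth[OF subspace_span span_base[OF that]])
    then have "x - proj (span X) x \<in> normal_cone X X" by (simp add: normal_cone_def)
    with p have "proj (span X) x + (x - proj (span X) x) \<in> minkowski_sum X (normal_cone X X)"
      unfolding minkowski_sum_def by blast
    then show "x \<in> minkowski_sum X (normal_cone X X)" by simp
  qed
  then show ?thesis by (simp add: conic_intrinsic_volume_def faces)
qed

lemma convex_minkowski_sum: "convex A \<Longrightarrow> convex B \<Longrightarrow> convex (minkowski_sum A B)"
proof -
  assume "convex A" "convex B"
  then have "convex (\<Union>x\<in>A. \<Union>y\<in>B. {x + y})" by (rule convex_sums)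
  also have "(\<Union>x\<in>A. \<Union>y\<in>B. {x + y}) = minkowski_sum A B" by (auto simp: minkowski_sum_def)
  finally show "convex (minkowski_sum A B)" .
qed

lemma span_minkowski_sum:
  assumes "0 \<in> A" "0 \<in> B"
  shows "span (minkowski_sum A B) = minkowski_sum (span A) (span B)"
proof
  show "span (minkowski_sum A B) \<subseteq> minkowski_sum (span A) (span B)"
  proof (rule span_minimal)
    show "minkowski_sum A B \<subseteq> minkowski_sum (span A) (span B)"
      unfolding minkowski_sum_def using span_base by blast
  qed (simp add: minkowski_sum_subspace)
  have "A \<subseteq> minkowski_sum A B" "B \<subseteq> minkowski_sum A B"
    using assms by (auto simp: minkowski_sum_def) (metis add.right_neutral, metis add.left_neutral)
  then have "span A \<subseteq> span (minkowski_sum A B)" "span B \<subseteq> span (minkowski_sum A B)"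
    by (simp_all add: span_mono)
  then show "minkowski_sum (span A) (span B) \<subseteq> span (minkowski_sum A B)"
    by (auto simp: minkowski_sum_def intro!: span_add)
qed

lemma dim_sum_rot:
  fixes L M :: "(real^'n) set"
  assumes L: "subspace L" and M: "subspace M" and \<theta>: "\<theta> \<in> SO"
  shows "dim (minkowski_sum L (rot \<theta> M)) \<le> dim L + dim M"
    and "dim (minkowski_sum L (rot \<theta> M)) = dim L + dim M \<longleftrightarrow> L \<inter> rot \<theta> M = {0}"
proof -
  have d: "dim (minkowski_sum L (rot \<theta> M)) + dim (L \<inter> rot \<theta> M) = dim L + dim M"
    using dim_sums_Int[OF L subspace_rot[OF M, of \<theta>]] by (simp add: minkowski_sum_def dim_rot[OF \<theta>])
  then show "dim (minkowski_sum L (rot \<theta> M)) \<le> dim L + dim M" by simp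
  have "0 \<in> L \<inter> rot \<theta> M" using subspace_0[OF L] subspace_0[OF subspace_rot[OF M]] by blast
  then have "dim (L \<inter> rot \<theta> M) = 0 \<longleftrightarrow> L \<inter> rot \<theta> M = {0}" by auto
  then show "dim (minkowski_sum L (rot \<theta> M)) = dim L + dim M \<longleftrightarrow> L \<inter> rot \<theta> M = {0}"
    using d by linarith
qed

text \<open>For a rotation, a nonzero common vector and its preimage can both be normalised.
  Witnesses then range over unit spheres, and the exceptional set is a countable union of
  projections of compact sets.\<close>

lemma measurable_Int_rot_trivial:
  fixes L M :: "(real^'n) set"
  assumes L: "subspace L" and M: "subspace M"
  obtains N where "N \<in> sets borel" "\<And>\<theta>. \<theta> \<in> SO \<Longrightarrow> \<theta> \<in> N \<longleftrightarrow> L \<inter> rot \<theta> M = {0}"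
proof -
  let ?T = "{p :: (real^'n) \<times> (real^'n) \<times> (real^'n^'n). fst p = snd (snd p) *v fst (snd p)}"
  define K where "K n = (snd \<circ> snd) ` (((L \<inter> sphere 0 1) \<times> (M \<inter> sphere 0 1) \<times> cball 0 (real n)) \<inter> ?T)" for n
  have "compact (K n)" for n
    unfolding K_def
  proof (rule compact_continuous_image)
    show "compact (((L \<inter> sphere 0 1) \<times> (M \<inter> sphere 0 1) \<times> cball 0 (real n)) \<inter> ?T)"
    proof (rule compact_Int_closed)
      show "compact ((L \<inter> sphere 0 1) \<times> (M \<inter> sphere 0 1) \<times> (cball 0 (real n) :: (real^'n^'n) set))"
        by (rule compact_Times closed_Int_compact closed_subspace L M compact_cball compact_sphere)+
      show "closed ?T"
        unfolding matrix_vector_mult_def by (intro closed_Collect_eq continuous_intros)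
    qed
  qed (auto intro!: continuous_intros)
  then have "K n \<in> sets borel" for n by (intro borel_closed compact_imp_closed)
  then have "(\<Union>n. K n) \<in> sets borel" by blast
  then have "- (\<Union>n. K n) \<in> sets borel" by (rule borel_comp)
  moreover have "\<theta> \<in> - (\<Union>n. K n) \<longleftrightarrow> L \<inter> rot \<theta> M = {0}" if \<theta>: "\<theta> \<in> SO" for \<theta>
  proof -
    have "(\<exists>n. \<theta> \<in> K n) \<longleftrightarrow> (\<exists>x\<in>L \<inter> rot \<theta> M. x \<noteq> 0)"
    proof
      assume "\<exists>n. \<theta> \<in> K n"
      then obtain y where "y \<in> M" "norm (\<theta> *v y) = 1" "\<theta> *v y \<in> L" by (auto simp: K_def)
      then show "\<exists>x\<in>L \<inter> rot \<theta> M. x \<noteq> 0"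
        by (intro bexI[of _ "\<theta> *v y"]) (auto simp: rot_def)
    next
      assume "\<exists>x\<in>L \<inter> rot \<theta> M. x \<noteq> 0"
      then obtain y where y: "\<theta> *v y \<in> L" "y \<in> M" "\<theta> *v y \<noteq> 0" by (auto simp: rot_def)
      have n: "norm (\<theta> *v z) = norm z" for z
        by (rule orthogonal_transformation_norm[OF SO_orthogonal_transformation[OF \<theta>]])
      define z where "z = (1 / norm y) *\<^sub>R y"
      have "y \<noteq> 0" using y(3) by auto
      then have z: "z \<in> M" "norm z = 1" "\<theta> *v z \<in> L"
        using y subspace_scale[OF M] subspace_scale[OF L]
        by (simp_all add: z_def matrix_vector_mult_scaleR)
      obtain k where "norm \<theta> \<le> real k" using real_arch_simple by blast
      then have "\<theta> \<in> K k"
        unfolding K_def using z n[of z] by (intro image_eqI[of _ _ "(\<theta> *v z, z, \<theta>)"]) auto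
      then show "\<exists>n. \<theta> \<in> K n" by blast
    qed
    moreover have "0 \<in> L \<inter> rot \<theta> M" using subspace_0[OF L] subspace_0[OF subspace_rot[OF M]] by blast
    ultimately show ?thesis by auto
  qed
  ultimately show thesis by (rule that)
qed

lemma gen_sine0_left:
  fixes L M :: "(real^'n) set"
  assumes "subspace L" "subspace M" "Q \<in> SO" "(*v) Q ` L = L"
  shows "gen_sine0 L (rot (Q ** \<theta>) M) = gen_sine0 L (rot \<theta> M)"
  using gen_sine0_orthogonal[OF assms(1) subspace_rot[OF assms(2), of \<theta>] SO_orthogonal_transformation[OF assms(3)]]
    assms(4) by (simp add: rot_mult rot_def[of Q])

text \<open>The constant c_ij(f) appears as its defining integral for the given pair of cones, and
  the strict inequality between the natural numbers amounts to k > 0.\<close>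

theorem theorem4p2:
  fixes C D :: "(real^'n) set" and nu :: "(real^'n^'n) measure"
    and f :: "real \<Rightarrow> real" and k :: nat
  assumes "CARD('n) \<ge> 2"
    and "haar_SO nu"
    and "polyhedral_cone C" and "polyhedral_cone D"
    and "dim C + dim D = CARD('n) - k" and "CARD('n) - k < CARD('n)"
    and "f \<in> borel_measurable (restrict_space borel {0..1})"
    and "bounded (f ` {0..1})"
  shows "(\<integral>\<theta>. conic_intrinsic_volume (CARD('n) - k) (minkowski_sum C (rot \<theta> D))
              * f (cone_sine C (rot \<theta> D)) \<partial>nu)
         = (\<integral>\<theta>. f (cone_sine C (rot \<theta> D)) \<partial>nu)
           * conic_intrinsic_volume (dim C) C * conic_intrinsic_volume (dim D) D"
proof -
  define L M where "L = span C" and "M = span D"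
  define mu where "mu = distr nu borel (\<lambda>x. x)"
  have L: "subspace L" and M: "subspace M" by (simp_all add: L_def M_def)
  interpret haar_rotation mu unfolding mu_def by (rule haar_rotation_distr(1)[OF assms(2)])
  have id: "(\<lambda>x. x) \<in> nu \<rightarrow>\<^sub>M borel" by (rule haar_rotation_distr(2)[OF assms(2)])
  have sp: "space nu = SO" using assms(2) by (simp add: haar_SO_def)
  have dims: "dim L + dim M = CARD('n) - k" "dim L + dim M < CARD('n)"
    using assms(5,6) by (simp_all add: L_def M_def)
  note clC = polyhedral_cone_closed[OF assms(3)] and clD = polyhedral_cone_closed[OF assms(4)]
  note C0 = polyhedral_cone_zero[OF assms(3)] and D0 = polyhedral_cone_zero[OF assms(4)]
  have Cb [measurable]: "C \<in> sets borel" and Db [measurable]: "D \<in> sets borel" using clC clD by simp_all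
  define a b where "a = measure std_gaussian {x. proj L x \<in> C}" and "b = measure std_gaussian {x. proj M x \<in> D}"
  have a: "emeasure std_gaussian {x. proj L x \<in> C} = ennreal a" and b: "emeasure std_gaussian {x. proj M x \<in> D} = ennreal b"
    by (simp_all add: a_def b_def std_gaussian.emeasure_eq_measure)
  have VC: "conic_intrinsic_volume (dim C) C = a" and VD: "conic_intrinsic_volume (dim D) D = b"
    using conic_intrinsic_volume_top[OF polyhedral_cone_convex[OF assms(3)] C0 order_refl]
      conic_intrinsic_volume_top[OF polyhedral_cone_convex[OF assms(4)] D0 order_refl]
    by (simp_all add: a_def b_def L_def M_def)
  obtain N where N [measurable]: "N \<in> sets borel" and N_iff: "\<And>\<theta>. \<theta> \<in> SO \<Longrightarrow> \<theta> \<in> N \<longleftrightarrow> L \<inter> rot \<theta> M = {0}"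
    by (rule measurable_Int_rot_trivial[OF L M]) (rule that)
  obtain s where s [measurable]: "s \<in> borel_measurable borel" and s_eq: "\<And>\<theta>. \<theta> \<in> SO \<Longrightarrow> gen_sine0 L (rot \<theta> M) = s \<theta>"
    by (rule gen_sine0_rot_measurable[OF L M]) (rule that)
  have s01: "s \<theta> \<in> {0..1}" if "\<theta> \<in> SO" for \<theta>
    using gen_sine0_bounds[OF L subspace_rot[OF M]] s_eq[OF that] by metis
  define J where "J \<theta> = inverse (gauss_coupling L M UNIV UNIV \<theta>) * gauss_coupling L M C D \<theta>" for \<theta>
  have [measurable]: "gauss_coupling L M UNIV UNIV \<in> borel_measurable borel" "gauss_coupling L M C D \<in> borel_measurable borel"
    using gauss_coupling_measurable[OF L M] Cb Db by auto
  have [measurable]: "J \<in> borel_measurable borel" unfolding J_def[abs_def] by measurable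
  \<comment> \<open>A Borel function on all matrices agreeing with the intrinsic volume of the sum
    on \<open>SO\<close>. The value 0 off \<open>N\<close> is the right one: there the sum has
    dimension below d - k and no face of that dimension.\<close>
  define V where "V \<theta> = (if \<theta> \<in> N then enn2real (J \<theta>) else 0)" for \<theta>
  have V_meas [measurable]: "V \<in> borel_measurable borel" unfolding V_def[abs_def] by measurable
  have J_em: "J \<theta> = emeasure std_gaussian {z. proj (minkowski_sum L (rot \<theta> M)) z \<in> minkowski_sum C (rot \<theta> D)}"
    if "\<theta> \<in> SO" "\<theta> \<in> N" for \<theta>
  proof -
    have "C \<subseteq> L" "D \<subseteq> M" by (auto simp: L_def M_def span_base)
    moreover have "L \<inter> rot \<theta> M = {0}" using that N_iff by blast
    ultimately show ?thesis
      unfolding J_def using emeasure_std_gaussian_sum_rot(1)[OF L M that(1) _ Cb _ clD] by simp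
  qed
  have V_val: "V \<theta> = (if \<theta> \<in> N then measure std_gaussian
      {z. proj (minkowski_sum L (rot \<theta> M)) z \<in> minkowski_sum C (rot \<theta> D)} else 0)" if "\<theta> \<in> SO" for \<theta>
  proof (cases "\<theta> \<in> N")
    case True
    then show ?thesis unfolding V_def J_em[OF that True] measure_def by (simp only: if_True)
  qed (simp add: V_def)
  have V_J: "ennreal (V \<theta>) = J \<theta>" if "\<theta> \<in> SO" "\<theta> \<in> N" for \<theta>
    unfolding V_val[OF that(1)] J_em[OF that] std_gaussian.emeasure_eq_measure using that(2) by simp
  have V_bound: "0 \<le> V \<theta>" "V \<theta> \<le> 1" if "\<theta> \<in> SO" for \<theta>
    unfolding V_val[OF that] by (auto simp: std_gaussian.prob_le_1)
  have V_eq: "conic_intrinsic_volume (CARD('n) - k) (minkowski_sum C (rot \<theta> D)) = V \<theta>" if "\<theta> \<in> SO" for \<theta>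
  proof -
    have cv: "convex (minkowski_sum C (rot \<theta> D))"
      unfolding rot_def
      by (intro convex_minkowski_sum polyhedral_cone_convex assms convex_linear_image) simp
    have r0: "0 \<in> rot \<theta> D" using D0 unfolding rot_def by force
    have "0 \<in> minkowski_sum C (rot \<theta> D)"
      unfolding minkowski_sum_def using C0 r0 by force
    moreover have sp: "span (minkowski_sum C (rot \<theta> D)) = minkowski_sum L (rot \<theta> M)"
      by (simp add: span_minkowski_sum[OF C0 r0] span_rot L_def M_def)
    then have dim: "dim (minkowski_sum C (rot \<theta> D)) = dim (minkowski_sum L (rot \<theta> M))"
      by (metis dim_span)
    moreover have "dim (minkowski_sum C (rot \<theta> D)) \<le> CARD('n) - k"
      unfolding dim using dim_sum_rot(1)[OF L M that] dims(1) by simp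
    moreover have "dim (minkowski_sum C (rot \<theta> D)) = CARD('n) - k \<longleftrightarrow> \<theta> \<in> N"
      unfolding dim dims(1)[symmetric] N_iff[OF that] by (rule dim_sum_rot(2)[OF L M that])
    ultimately show ?thesis
      using conic_intrinsic_volume_top[OF cv, of "CARD('n) - k"] by (simp only: sp V_val[OF that])
  qed
  \<comment> \<open>\<open>f\<close> is measurable on [0,1] only. Clamping the argument extends it
    to a bounded Borel function on the line without changing its values at sines.\<close>
  define F where "F t = f (max 0 (min 1 t))" for t
  have F_meas [measurable]: "F \<in> borel_measurable borel"
  proof -
    have "(\<lambda>t::real. max 0 (min 1 t)) \<in> borel \<rightarrow>\<^sub>M restrict_space borel {0..1}"
      by (rule measurable_restrict_space2) auto
    from measurable_compose[OF this assms(7)] show ?thesis by (simp add: F_def[abs_def])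
  qed
  obtain K where "\<forall>y\<in>f ` {0..1}. norm y \<le> K"
    using assms(8) unfolding bounded_iff by blast
  then have K: "\<bar>f t\<bar> \<le> K" if "t \<in> {0..1}" for t using that by auto
  have FK: "\<bar>F t\<bar> \<le> K" for t unfolding F_def by (rule K) auto
  have K0: "0 \<le> K" using FK[of 0] by linarith
  have f_eq: "f (cone_sine C (rot \<theta> D)) = F (s \<theta>)" if "\<theta> \<in> SO" for \<theta>
  proof -
    have "cone_sine C (rot \<theta> D) = s \<theta>"
      using cone_sine_rot[OF that, of C D] s_eq[OF that] assms(5) by (simp add: L_def M_def)
    then show ?thesis using s01[OF that] by (simp add: F_def)
  qed
  have s_left: "s (Q ** \<theta>) = s \<theta>" if "Q \<in> SO" "\<theta> \<in> SO" "(*v) Q ` L = L" for Q \<theta>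
    using gen_sine0_left[OF L M that(1,3), of \<theta>] by (simp add: s_eq that SO_mult)
  have s_right: "s (\<theta> ** Q) = s \<theta>" if "Q \<in> SO" "\<theta> \<in> SO" "(*v) Q ` M = M" for Q \<theta>
  proof -
    have "rot (\<theta> ** Q) M = rot \<theta> M" using that(3) by (simp add: rot_mult) (simp add: rot_def)
    then show ?thesis using s_eq[OF that(2)] s_eq[OF SO_mult[OF that(2,1)]] by simp
  qed
  have AE_N: "AE \<theta> in mu. \<theta> \<in> SO \<and> \<theta> \<in> N"
    using AE_SO AE_Int_rot_trivial[OF L M dims(2)] by eventually_elim (simp add: N_iff)
  \<comment> \<open>For nonnegative \<open>p\<close> the real integrals can be read off from the
    extended ones through \<open>enn2real\<close>, without integrability of
    \<open>p\<close>.\<close>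
  have main: "(\<integral>\<theta>. V \<theta> * p (s \<theta>) \<partial>mu) = (\<integral>\<theta>. p (s \<theta>) \<partial>mu) * a * b"
    if [measurable]: "p \<in> borel_measurable borel" and p: "\<And>t. 0 \<le> p t" for p :: "real \<Rightarrow> real"
  proof -
    have "(\<integral>\<^sup>+\<theta>. ennreal (V \<theta> * p (s \<theta>)) \<partial>mu) = (\<integral>\<^sup>+\<theta>. ennreal (p (s \<theta>)) * J \<theta> \<partial>mu)"
      by (rule nn_integral_cong_AE)
         (use AE_N in \<open>eventually_elim, simp add: ennreal_mult V_bound p V_J[symmetric] mult.commute\<close>)
    also have "\<dots> = ennreal a * ennreal b * (\<integral>\<^sup>+\<theta>. ennreal (p (s \<theta>)) \<partial>mu)"
      unfolding J_def a[symmetric] b[symmetric]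
      by (rule nn_integral_gauss_coupling[OF L M dims(2) Cb polyhedral_cone_scale[OF assms(3)] Db polyhedral_cone_scale[OF assms(4)]])
         (simp_all add: s_left s_right)
    finally have eq: "(\<integral>\<^sup>+\<theta>. ennreal (V \<theta> * p (s \<theta>)) \<partial>mu) = ennreal a * ennreal b * (\<integral>\<^sup>+\<theta>. ennreal (p (s \<theta>)) \<partial>mu)" .
    have "(\<integral>\<theta>. V \<theta> * p (s \<theta>) \<partial>mu) = enn2real (\<integral>\<^sup>+\<theta>. ennreal (V \<theta> * p (s \<theta>)) \<partial>mu)"
      by (rule integral_eq_nn_integral, measurable)
        (use AE_N in \<open>eventually_elim, simp add: V_bound p\<close>)
    also have "\<dots> = a * b * enn2real (\<integral>\<^sup>+\<theta>. ennreal (p (s \<theta>)) \<partial>mu)"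
      unfolding eq by (simp add: enn2real_mult a_def b_def)
    also have "enn2real (\<integral>\<^sup>+\<theta>. ennreal (p (s \<theta>)) \<partial>mu) = (\<integral>\<theta>. p (s \<theta>) \<partial>mu)"
      by (rule integral_eq_nn_integral[symmetric], measurable) (simp add: p)
    finally show ?thesis by (simp add: mult_ac)
  qed
  have intF: "integrable mu (\<lambda>\<theta>. F (s \<theta>))"
  proof (rule integrable_const_bound[of _ K])
    show "AE \<theta> in mu. norm (F (s \<theta>)) \<le> K" by (simp add: FK)
  qed measurable
  have intV: "integrable mu V"
  proof (rule integrable_const_bound[of _ 1])
    show "AE \<theta> in mu. norm (V \<theta>) \<le> 1"
      using AE_SO by eventually_elim (simp add: V_bound)
  qed measurable
  have intVF: "integrable mu (\<lambda>\<theta>. V \<theta> * F (s \<theta>))"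
  proof (rule integrable_const_bound[of _ K])
    show "AE \<theta> in mu. norm (V \<theta> * F (s \<theta>)) \<le> K"
      using AE_SO
    proof eventually_elim
      fix \<theta> :: "real^'n^'n" assume "\<theta> \<in> SO"
      then have "\<bar>V \<theta>\<bar> * \<bar>F (s \<theta>)\<bar> \<le> 1 * K" by (intro mult_mono) (auto simp: V_bound FK)
      then show "norm (V \<theta> * F (s \<theta>)) \<le> K" by (simp add: abs_mult)
    qed
  qed measurable
  \<comment> \<open>\<open>F\<close> may change sign. Adding its bound \<open>K\<close> makes it
    nonnegative, and the constant function \<open>K\<close> satisfies the same identity, so its
    contribution cancels.\<close>
  have FK0: "0 \<le> F t + K" for t using FK[of t] by linarith
  have "(\<integral>\<theta>. V \<theta> * F (s \<theta>) \<partial>mu) + (\<integral>\<theta>. V \<theta> * K \<partial>mu) = (\<integral>\<theta>. V \<theta> * (F (s \<theta>) + K) \<partial>mu)"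
    unfolding distrib_left by (rule Bochner_Integration.integral_add[symmetric]) (use intVF intV in simp_all)
  also have "\<dots> = (\<integral>\<theta>. F (s \<theta>) + K \<partial>mu) * a * b"
    by (rule main[of "\<lambda>t. F t + K"]) (simp_all add: FK0)
  also have "\<dots> = (\<integral>\<theta>. F (s \<theta>) \<partial>mu) * a * b + (\<integral>\<theta>. K \<partial>mu) * a * b"
    by (subst Bochner_Integration.integral_add) (use intF in \<open>simp_all add: distrib_right\<close>)
  also have "(\<integral>\<theta>. K \<partial>mu) * a * b = (\<integral>\<theta>. V \<theta> * K \<partial>mu)"
    by (rule main[of "\<lambda>_. K", symmetric]) (simp_all add: K0)
  finally have VF: "(\<integral>\<theta>. V \<theta> * F (s \<theta>) \<partial>mu) = (\<integral>\<theta>. F (s \<theta>) \<partial>mu) * a * b" by simp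
  \<comment> \<open>The return to \<open>nu\<close> asks for Borel functions on the full matrix
    space, which is what \<open>V\<close> and the composite of \<open>F\<close> with
    \<open>s\<close> provide.\<close>
  have to_mu: "(\<integral>\<theta>. g \<theta> \<partial>nu) = (\<integral>\<theta>. g \<theta> \<partial>mu)" if "g \<in> borel_measurable borel" for g :: "real^'n^'n \<Rightarrow> real"
    unfolding mu_def using integral_distr[OF id that] by simp
  have "(\<lambda>\<theta>. V \<theta> * F (s \<theta>)) \<in> borel_measurable borel" "(\<lambda>\<theta>. F (s \<theta>)) \<in> borel_measurable borel"
    by measurable
  note mm = to_mu[OF this(1)] to_mu[OF this(2)]
  have "(\<integral>\<theta>. conic_intrinsic_volume (CARD('n) - k) (minkowski_sum C (rot \<theta> D)) * f (cone_sine C (rot \<theta> D)) \<partial>nu)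
     = (\<integral>\<theta>. V \<theta> * F (s \<theta>) \<partial>nu)"
    by (rule Bochner_Integration.integral_cong) (simp_all add: sp V_eq f_eq)
  moreover have "(\<integral>\<theta>. f (cone_sine C (rot \<theta> D)) \<partial>nu) = (\<integral>\<theta>. F (s \<theta>) \<partial>nu)"
    by (rule Bochner_Integration.integral_cong) (simp_all add: sp f_eq)
  ultimately show ?thesis by (simp only: mm VF VC VD)
qed

end
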